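(* Let $F$ be a field of characteristic $0$ and $n\ge 1$ an integer. Then the algebra $T_n$ of monotypically supersymmetric polynomials is generated, as an $F$-algebra, by the odd power sums $p_{2k+1}$, $k=0,1,2,\dots$. Moreover, the proper products form a linear basis of $T_n$ over $F$; that is, the family of proper products, indexed by their data $(c_1,c_3,\dots,c_{2j+1};\{m_1,\dots,m_{i'}\})$ with $c_{2\ell+1}\ge 0$, $0\le i'\le i$, and $\{m_1,\dots,m_{i'}\}$ a multiset of integers $>j$, is linearly independent and spans $T_n$.
   Context: $F$ is a field with $\operatorname{char}F=0$. For $n\ge 1$ and $k\ge 0$, $p_k=x_1^k+\dots+x_n^k\in F[x_1,\dots,x_n]$ (power sums). A polynomial $p\in F[x_1,\dots,x_n]$ is called monotypically supersymmetric if (1) $p$ is invariant under all permutations of $x_1,\dots,x_n$, and (2) after the substitution $x_1=t,\ x_2=-t$ (other variables unchanged) the resulting polynomial does not depend on $t$. $T_n$ denotes the $F$-algebra of monotypically supersymmetric polynomials in $n$ variables. Put $i=i(n)=\lfloor n/2\rfloor$ (largest integer with $2i\le n$) and $j=j(n)=\lfloor (n-1)/2\rfloor$ (largest integer with $2j+1\le n$). A proper product is a polynomial of the form $p_1^{c_1}p_3^{c_3}\cdots p_{2j+1}^{c_{2j+1}}\,p_{2m_1+1}\cdots p_{2m_{i'}+1}$ where $c_1,c_3,\dots,c_{2j+1}\ge 0$ are integers, $0\le i'\le i$, and $m_1,\dots,m_{i'}$ are integers with $m_k>j$ for all $k$ (i.e. it contains at most $i$ factors $p_{2m+1}$ with $m>j$,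 counted with multiplicity). *)

theory Defs
  imports "HOL-Library.Poly_Mapping" "HOL-Library.Multiset" "HOL-Combinatorics.Permutations"
begin

(* Multivariate polynomials over 'a: finitely supported maps from monomials
   (finitely supported exponent vectors nat =>0 nat) to coefficients.
   Variable x_(k+1) of the paper is  Var k  (variables indexed from 0). *)
type_synonym 'a mpoly = "(nat \<Rightarrow>\<^sub>0 nat) \<Rightarrow>\<^sub>0 'a"

definition Const :: "'a::zero \<Rightarrow> 'a mpoly" where
  "Const c = Poly_Mapping.single 0 c"

definition Var :: "nat \<Rightarrow> 'a::{zero,one} mpoly" where
  "Var k = Poly_Mapping.single (Poly_Mapping.single k 1) 1"

definition poly_in_vars :: "nat \<Rightarrow> 'a::zero mpoly \<Rightarrow> bool" where
  "poly_in_vars n p \<longleftrightarrow> (\<forall>m\<in>Poly_Mapping.keys p. Poly_Mapping.keys m \<subseteq> {..<n})"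

definition subst :: "(nat \<Rightarrow> 'a::comm_ring_1 mpoly) \<Rightarrow> 'a mpoly \<Rightarrow> 'a mpoly" where
  "subst \<sigma> p = (\<Sum>m\<in>Poly_Mapping.keys p.
      Const (Poly_Mapping.lookup p m) * (\<Prod>v\<in>Poly_Mapping.keys m. \<sigma> v ^ Poly_Mapping.lookup m v))"

definition psum :: "nat \<Rightarrow> nat \<Rightarrow> 'a::comm_ring_1 mpoly" where
  "psum n k = (\<Sum>v<n. Var v ^ k)"

(* monotypically supersymmetric polynomials in n variables.
   Condition (2): substitute x_1 = t, x_2 = -t where t is the fresh variable Var n;
   the result must not involve t.  For n = 1 there is no x_2 and condition (2) is vacuous. *)
definition T :: "nat \<Rightarrow> 'a::comm_ring_1 mpoly set" where
  "T n = {p. poly_in_vars n p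
           \<and> (\<forall>\<pi>. \<pi> permutes {..<n} \<longrightarrow> subst (\<lambda>v. Var (\<pi> v)) p = p)
           \<and> (2 \<le> n \<longrightarrow>
               (\<forall>m\<in>Poly_Mapping.keys
                   (subst (\<lambda>v. if v = 0 then Var n else if v = 1 then - Var n else Var v) p).
                  Poly_Mapping.lookup m n = 0))}"

inductive_set subalg_gen :: "'a::comm_ring_1 mpoly set \<Rightarrow> 'a mpoly set" for S where
  const: "Const c \<in> subalg_gen S"
| gen: "s \<in> S \<Longrightarrow> s \<in> subalg_gen S"
| add: "p \<in> subalg_gen S \<Longrightarrow> q \<in> subalg_gen S \<Longrightarrow> p + q \<in> subalg_gen S"
| mult: "p \<in> subalg_gen S \<Longrightarrow> q \<in> subalg_gen S \<Longrightarrow> p * q \<in> subalg_gen S"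

(* proper products: data (c, M) where c l = c_(2l+1) for l <= j (c l = 0 for l > j),
   M a multiset of integers > j with at most i elements *)
definition proper_index :: "nat \<Rightarrow> ((nat \<Rightarrow> nat) \<times> nat multiset) set" where
  "proper_index n = {(c, M). (\<forall>l. (n - 1) div 2 < l \<longrightarrow> c l = 0)
                         \<and> (\<forall>m\<in>#M. (n - 1) div 2 < m) \<and> size M \<le> n div 2}"

definition proper_prod :: "nat \<Rightarrow> (nat \<Rightarrow> nat) \<times> nat multiset \<Rightarrow> 'a::comm_ring_1 mpoly" where
  "proper_prod n cM = (case cM of (c, M) \<Rightarrow>
      (\<Prod>l\<le>(n - 1) div 2. psum n (2 * l + 1) ^ c l) * prod_mset (image_mset (\<lambda>m. psum n (2 * m + 1)) M))"

end

theory Submission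
  imports Defs "HOL-Computational_Algebra.Computational_Algebra"
    "HOL-Algebra.Algebraic_Closure_Type" "Jordan_Normal_Form.Determinant"
begin

text \<open>
  Spanning is a dimension count. If the lexicographically leading exponent of a polynomial
  in \<open>T n\<close> had two equal positive entries \<open>r\<close>, then substituting \<open>t\<close> and \<open>- t\<close> for the two
  variables would leave a nonzero coefficient at \<open>t ^ (2 * r)\<close>; so leading exponents are strict
  partitions with at most \<open>n\<close> parts. Sylvester's bijection sends these, degree by degree, injectively
  to proper products, so linearly independent proper products already span.

  For independence, write \<open>\<Prod> (1 + \<xi> v * z) = E + c * E * \<tau>\<close> with \<open>E\<close> even and \<open>\<tau>\<close> an odd power
  series. The odd power sums of \<open>\<xi>\<close> are \<open>c * (2 * k + 1) * \<tau> k\<close> up to higher order in \<open>c\<close>, so the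
  lowest order in \<open>c\<close> of a relation is a relation between products of the coefficients
  \<open>\<tau> k\<close>. For \<open>k \<le> j\<close> these can be prescribed; near \<open>(0, \<dots>, 0, 1)\<close> the remaining ones are the complete
  symmetric functions of the parameters of \<open>E\<close>. Products of at most \<open>i\<close> complete symmetric functions
  in \<open>i\<close> variables are independent, because by Jacobi--Trudi their span contains as many independent
  alternants as there are products.
\<close>

section \<open>Linear algebra over a field\<close>

text \<open>The numbers i and j are the degree bounds of the two halves of one polynomial: for Q of
  degree at most i and R of degree at most j, N(z) = Q(z^2) + c z R(z^2) has degree at most n. If
  Q(0) = 1, then N splits into n factors 1 + \<xi> v z over an algebraically closed field, which is
  why relations are tested in the algebraic closure. Half the logarithmic derivative of N(z) / N(-z)
  generates the odd power sums. It equals the derivative of artanh(c \<tau>) with \<tau> = z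
  (R/Q)(z^2), so only R/Q matters, and c is a scale that separates products by their number of
  factors.

  The obstacle is that at the parameters (0, ..., 0, 1), where the high coefficients of R/Q turn
  into complete symmetric functions, the low coefficients degenerate and whole products vanish.
  Evaluating there would lose information. The point is therefore approached along lines with
  parameter \<epsilon>, and coefficients are kept as polynomials in \<epsilon>.

  The leading exponents only bound the dimension from above. Hence independence feeds into spanning,
  and Sylvester's map is needed as an injection only.\<close>

lemma nontrivial_solution:
  fixes c :: "'i \<Rightarrow> 's \<Rightarrow> 'a::field"
  assumes "finite S" "finite I" "card S < card I"
  shows "\<exists>a. (\<exists>i\<in>I. a i \<noteq> 0) \<and> (\<forall>s\<in>S. (\<Sum>i\<in>I. a i * c i s) = 0)"
  using assms
proof (induction S arbitrary: I c rule: finite_induct)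
  case empty
  then have "I \<noteq> {}" by auto
  then show ?case by (intro exI[of _ "\<lambda>_. 1"]) auto
next
  case (insert s S)
  show ?case
  proof (cases "\<forall>i\<in>I. c i s = 0")
    case True
    have "card S < card I" using insert by simp
    from insert.IH[OF insert.prems(1) this, of c] True show ?thesis by auto
  next
    case False
    then obtain k where k: "k \<in> I" "c k s \<noteq> 0" by blast
    define I' where "I' = I - {k}"
    have I: "I = insert k I'" "k \<notin> I'" "finite I'" using k insert.prems by (auto simp: I'_def)
    have "card S < card I'" using insert I by simp
    \<comment> \<open>Equation \<open>s\<close> is solved for the unknown \<open>k\<close>; these
      are the coefficients of the other equations after the elimination.\<close>
    from insert.IH[OF I(3) this, of "\<lambda>i t. c i t - c i s / c k s * c k t"]
    obtain a where a: "\<exists>i\<in>I'. a i \<noteq> 0"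
      "\<And>t. t \<in> S \<Longrightarrow> (\<Sum>i\<in>I'. a i * (c i t - c i s / c k s * c k t)) = 0" by auto
    define r where "r = (\<Sum>i\<in>I'. a i * c i s) / c k s"
    define b where "b = a(k := - r)"
    have b: "(\<Sum>i\<in>I. b i * c i t) = (\<Sum>i\<in>I'. a i * c i t) - r * c k t" for t
    proof -
      have "(\<Sum>i\<in>I'. b i * c i t) = (\<Sum>i\<in>I'. a i * c i t)"
        using I(2) by (intro sum.cong) (auto simp: b_def)
      then show ?thesis using I by (simp add: b_def)
    qed
    have "(\<Sum>i\<in>I. b i * c i t) = 0" if "t \<in> insert s S" for t
    proof (cases "t = s")
      case True
      then show ?thesis using k by (simp add: b r_def)
    next
      case False
      then have "t \<in> S" using that by simp
      from a(2)[OF this] show ?thesis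
        by (simp add: b r_def algebra_simps sum_subtractf sum_distrib_left sum_distrib_right sum_divide_distrib)
    qed
    moreover have "\<exists>i\<in>I. b i \<noteq> 0" using a(1) I by (auto simp: b_def)
    ultimately show ?thesis by blast
  qed
qed

text \<open>A relation among the \<open>v i\<close> would express one of them by the others, so all
  \<open>u j\<close> would lie in the span of fewer than \<open>card J\<close> functions and could
  not be independent. Equations at every point \<open>w\<close> stand in for a vector space of
  functions.\<close>

lemma independent_by_counting:
  fixes v :: "'i \<Rightarrow> 'w \<Rightarrow> 'a::field" and u :: "'j \<Rightarrow> 'w \<Rightarrow> 'a"
  assumes fin: "finite I" "finite J" and card: "card I \<le> card J"
    and indep: "\<And>b. (\<And>w. (\<Sum>j\<in>J. b j * u j w) = 0) \<Longrightarrow> (\<forall>j\<in>J. b j = 0)"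
    and span: "\<And>j w. j \<in> J \<Longrightarrow> u j w = (\<Sum>i\<in>I. m j i * v i w)"
    and zero: "\<And>w. (\<Sum>i\<in>I. a i * v i w) = 0"
  shows "\<forall>i\<in>I. a i = 0"
proof (rule ccontr)
  assume "\<not> ?thesis"
  then obtain k where k: "k \<in> I" "a k \<noteq> 0" by blast
  define I' where "I' = I - {k}"
  have I: "I = insert k I'" "k \<notin> I'" "finite I'" using k fin by (auto simp: I'_def)
  have vk: "v k w = (\<Sum>i\<in>I'. - (a i / a k) * v i w)" for w
  proof -
    have "a k * v k w = - (\<Sum>i\<in>I'. a i * v i w)"
      using zero[of w] I by (simp add: add_eq_0_iff)
    then have "v k w = - (\<Sum>i\<in>I'. a i * v i w) / a k" using k by (simp add: field_simps)
    then show ?thesis by (simp add: sum_divide_distrib sum_negf)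
  qed
  have "card I' < card J" using card I fin by simp
  from nontrivial_solution[OF I(3) fin(2) this, of "\<lambda>j i. m j i - m j k * (a i / a k)"]
  obtain b where b: "\<exists>j\<in>J. b j \<noteq> 0"
    "\<And>i. i \<in> I' \<Longrightarrow> (\<Sum>j\<in>J. b j * (m j i - m j k * (a i / a k))) = 0" by auto
  have "(\<Sum>j\<in>J. b j * u j w) = 0" for w
  proof -
    have "u j w = (\<Sum>i\<in>I'. (m j i - m j k * (a i / a k)) * v i w)" if "j \<in> J" for j
      using span[OF that, of w] I
      by (simp add: vk[of w] sum_distrib_left sum.distrib[symmetric] algebra_simps sum_subtractf sum_negf)
    then have "(\<Sum>j\<in>J. b j * u j w) = (\<Sum>j\<in>J. b j * (\<Sum>i\<in>I'. (m j i - m j k * (a i / a k)) * v i w))"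
      by simp
    also have "\<dots> = (\<Sum>i\<in>I'. (\<Sum>j\<in>J. b j * (m j i - m j k * (a i / a k))) * v i w)"
      by (subst sum_distrib_left, subst sum.swap) (simp add: sum_distrib_right mult.assoc)
    also have "\<dots> = 0" using b(2) by simp
    finally show ?thesis .
  qed
  from indep[OF this] b(1) show False by blast
qed

lemma poly_eq_0_if_vanishes:
  fixes p :: "'a::field_char_0 poly"
  assumes "\<And>x. poly p x = 0"
  shows "p = 0"
  using assms poly_all_0_iff_0 by blast

text \<open>Induction on the number of variables: with the other values fixed, the sum is a
  polynomial in the last variable, and each of its coefficients is a relation in fewer
  variables.\<close>

lemma monomials_independent:
  fixes a :: "'x \<Rightarrow> 'a::field_char_0" and k :: nat
  assumes "finite A"
    and "\<And>x y. x \<in> A \<Longrightarrow> y \<in> A \<Longrightarrow> (\<And>l. l < k \<Longrightarrow> e x l = e y l) \<Longrightarrow> x = y"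
    and "\<And>w. (\<Sum>x\<in>A. a x * (\<Prod>l<k. w l ^ e x l)) = 0"
  shows "\<forall>x\<in>A. a x = 0"
  using assms
proof (induction k arbitrary: A)
  case 0
  show ?case
  proof
    fix x assume "x \<in> A"
    then have "A = {x}" using "0.prems"(2) by auto
    then show "a x = 0" using "0.prems"(3) by simp
  qed
next
  case (Suc k)
  show ?case
  proof
    fix x assume x: "x \<in> A"
    define Y where "Y = {y \<in> A. e y k = e x k}"
    have "(\<Sum>y\<in>Y. a y * (\<Prod>l<k. w l ^ e y l)) = 0" for w
    proof -
      define p where "p = (\<Sum>y\<in>A. Polynomial.monom (a y * (\<Prod>l<k. w l ^ e y l)) (e y k))"
      have "poly p z = 0" for z
      proof -
        have "(\<Prod>l<k. (w(k := z)) l ^ e y l) = (\<Prod>l<k. w l ^ e y l)" for y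
          by (intro prod.cong) auto
        then show ?thesis
          using Suc.prems(3)[of "w(k := z)"] by (simp add: p_def poly_sum poly_monom mult.assoc)
      qed
      then have "coeff p (e x k) = 0" using poly_eq_0_if_vanishes[of p] by simp
      moreover have "coeff p (e x k) = (\<Sum>y\<in>A. if e y k = e x k then a y * (\<Prod>l<k. w l ^ e y l) else 0)"
        by (simp add: p_def coeff_sum)
      moreover have "\<dots> = (\<Sum>y\<in>Y. a y * (\<Prod>l<k. w l ^ e y l))"
        unfolding Y_def using Suc.prems(1) by (simp add: sum.inter_filter)
      ultimately show ?thesis by simp
    qed
    moreover have "y = z" if "y \<in> Y" "z \<in> Y" "\<And>l. l < k \<Longrightarrow> e y l = e z l" for y z
    proof (rule Suc.prems(2))
      fix l assume "l < Suc k"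
      then show "e y l = e z l" using that by (cases "l = k") (auto simp: Y_def)
    qed (use that in \<open>auto simp: Y_def\<close>)
    ultimately have "\<forall>y\<in>Y. a y = 0"
      using Suc.prems(1) by (intro Suc.IH) (auto simp: Y_def)
    then show "a x = 0" using x by (simp add: Y_def)
  qed
qed

section \<open>Products of complete symmetric functions\<close>

definition complete_sym :: "nat \<Rightarrow> (nat \<Rightarrow> 'a::field) \<Rightarrow> nat \<Rightarrow> 'a" where
  "complete_sym i w r = fps_nth (inverse (fps_of_poly (\<Prod>s<i. [:1, - w s:]))) r"

lemma complete_sym_0 [simp]: "complete_sym i w 0 = 1"
proof -
  have "coeff (\<Prod>s<i. [:1, - w s:]) 0 = (\<Prod>s<i. 1)"
    by (simp add: poly_0_coeff_0[symmetric] poly_prod)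
  then show ?thesis by (simp add: complete_sym_def)
qed

text \<open>The generating function of the powers of \<open>w s\<close> is the reciprocal of one
  linear factor, hence the product of the other factors divided by the product of all. The claim is
  coefficient \<open>k\<close> of this identity. The degree of the numerator gives the range
  \<open>b < i\<close>; the \<open>if\<close> stands for complete symmetric functions of negative
  index.\<close>

lemma power_eq_sum_complete_sym:
  fixes w :: "nat \<Rightarrow> 'a::field"
  assumes "s < i"
  defines "e \<equiv> \<lambda>b. coeff (\<Prod>t\<in>{..<i} - {s}. [:1, - w t:]) b"
  shows "w s ^ k = (\<Sum>b<i. (if b \<le> k then complete_sym i w (k - b) else 0) * e b)"
proof -
  define E where "E = (\<Prod>t\<in>{..<i} - {s}. [:1, - w t:])"
  define G where "G = (\<Prod>t<i. [:1, - w t:])"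
  have G: "G = [:1, - w s:] * E" unfolding G_def E_def using assms(1) by (subst prod.remove[of _ s]) auto
  have deg: "degree E < i"
  proof -
    have "degree E \<le> (\<Sum>t\<in>{..<i} - {s}. degree [:1, - w t:])"
      unfolding E_def by (rule order.trans[OF degree_prod_sum_le]) simp_all
    also have "\<dots> \<le> (\<Sum>t\<in>{..<i} - {s}. 1)" by (intro sum_mono) simp
    also have "\<dots> = i - 1" using assms(1) by simp
    finally show ?thesis using assms(1) by simp
  qed
  have G0: "coeff G 0 = 1" by (simp add: G_def poly_0_coeff_0[symmetric] poly_prod)
  have lin: "fps_of_poly [:1, - w s:] = 1 - fps_const (w s) * fps_X"
    by (rule fps_ext) (auto simp: fps_of_poly_nth coeff_pCons split: nat.splits)
  have geo: "Abs_fps (\<lambda>n. w s ^ n) * (1 - fps_const (w s) * fps_X) = 1"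
    by (rule fps_ext) (auto simp: algebra_simps fps_mult_left_const_nth simp flip: power_Suc)
  have "Abs_fps (\<lambda>n. w s ^ n) * fps_of_poly G = fps_of_poly E"
    unfolding G fps_of_poly_mult lin mult.assoc[symmetric] geo by simp
  then have "Abs_fps (\<lambda>n. w s ^ n) * (fps_of_poly G * inverse (fps_of_poly G)) = fps_of_poly E * inverse (fps_of_poly G)"
    by (simp only: mult.assoc[symmetric])
  then have "Abs_fps (\<lambda>n. w s ^ n) = fps_of_poly E * inverse (fps_of_poly G)"
    using inverse_mult_eq_1'[of "fps_of_poly G"] G0 by simp
  then have "w s ^ k = fps_nth (fps_of_poly E * inverse (fps_of_poly G)) k"
    by (metis fps_nth_Abs_fps)
  also have "\<dots> = (\<Sum>b\<le>k. coeff E b * complete_sym i w (k - b))"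
    by (simp add: fps_mult_nth complete_sym_def G_def atLeast0AtMost)
  also have "\<dots> = (\<Sum>b\<in>{..k} \<inter> {..<i}. coeff E b * complete_sym i w (k - b))"
    using deg by (intro sum.mono_neutral_right) (auto dest!: le_degree)
  also have "\<dots> = (\<Sum>b<i. (if b \<le> k then complete_sym i w (k - b) else 0) * coeff E b)"
    by (intro sum.mono_neutral_cong_left) auto
  finally show ?thesis unfolding e_def E_def .
qed

text \<open>Jacobi--Trudi; it only matters that the first factor does not depend on \<open>\<kappa>\<close>.\<close>

lemma det_powers_eq:
  fixes \<kappa> :: "nat \<Rightarrow> nat" and w :: "nat \<Rightarrow> 'a::field"
  shows "det (mat i i (\<lambda>(a, s). w s ^ \<kappa> a)) =
    det (mat i i (\<lambda>(b, s). coeff (\<Prod>t\<in>{..<i} - {s}. [:1, - w t:]) b)) *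
    det (mat i i (\<lambda>(a, b). if b \<le> \<kappa> a then complete_sym i w (\<kappa> a - b) else 0))"
    (is "det ?A = det ?E * det ?H")
proof -
  have "?A = ?H * ?E"
  proof (rule eq_matI)
    fix a s assume "a < dim_row (?H * ?E)" "s < dim_col (?H * ?E)"
    then have as: "a < i" "s < i" by auto
    then show "?A $$ (a, s) = (?H * ?E) $$ (a, s)"
      using power_eq_sum_complete_sym[of s i w "\<kappa> a"]
      by (simp add: scalar_prod_def atLeast0LessThan)
  qed auto
  then show ?thesis
    using det_mult[of ?H i ?E] by (simp add: mult.commute)
qed

text \<open>The staircase shift turns multisets of size \<open>i\<close> into sets of size
  \<open>i\<close>, the exponent sets of alternants.\<close>

lemma sorted_padded_strict:
  assumes "sorted (xs::nat list)"
  shows "sorted_wrt (<) (map (\<lambda>a. xs ! a + a) [0..<length xs])"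
  unfolding sorted_wrt_iff_nth_less
proof (intro allI impI)
  fix a b assume "a < b" "b < length (map (\<lambda>a. xs ! a + a) [0..<length xs])"
  then have "xs ! a \<le> xs ! b" "b < length xs" using assms by (auto intro: sorted_nth_mono)
  then show "map (\<lambda>a. xs ! a + a) [0..<length xs] ! a < map (\<lambda>a. xs ! a + a) [0..<length xs] ! b"
    using \<open>a < b\<close> by simp
qed

text \<open>Every alternant is \<open>D\<close> times a signed sum of products indexed by
  \<open>I\<close>, and the staircase shift \<open>\<phi>\<close> embeds \<open>I\<close> into the
  set \<open>J\<close> of exponent sets. The bound \<open>d\<close> makes both finite.
  \<open>D w\<close> may vanish for some \<open>w\<close>; relations are only multiplied by it,
  never divided.\<close>

lemma complete_sym_products_independent:
  fixes a :: "nat multiset \<Rightarrow> 'a::field_char_0"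
  assumes fin: "finite \<M>" and size: "\<And>M. M \<in> \<M> \<Longrightarrow> size M = i"
    and zero: "\<And>w. (\<Sum>M\<in>\<M>. a M * (\<Prod>m\<in>#M. complete_sym i w m)) = 0"
  shows "\<forall>M\<in>\<M>. a M = 0"
proof -
  define d where "d = (\<Sum>M\<in>\<M>. sum_mset M)"
  define I where "I = {M::nat multiset. size M = i \<and> sum_mset M \<le> d}"
  define J where "J = {A::nat set. finite A \<and> card A = i \<and> \<Sum>A \<le> d + \<Sum>{..<i}}"
  define h where "h = (\<lambda>w::nat \<Rightarrow> 'a. complete_sym i w)"
  define D where "D = (\<lambda>w::nat \<Rightarrow> 'a. det (mat i i (\<lambda>(b, s). coeff (\<Prod>t\<in>{..<i} - {s}. [:1, - w t:]) b)))"
  have finJ: "finite J"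
  proof (rule finite_subset)
    show "J \<subseteq> Pow {..d + \<Sum>{..<i}}"
    proof
      fix A assume "A \<in> J"
      then have A: "finite A" "\<Sum>A \<le> d + \<Sum>{..<i}" by (auto simp: J_def)
      have "x \<le> \<Sum>A" if "x \<in> A" for x using A that by (intro member_le_sum[of _ _ "\<lambda>x. x", simplified]) auto
      with A show "A \<in> Pow {..d + \<Sum>{..<i}}" by (auto intro: order.trans)
    qed
  qed simp
  define \<phi> where "\<phi> = (\<lambda>M::nat multiset. set (map (\<lambda>a. sorted_list_of_multiset M ! a + a) [0..<size M]))"
  have len: "length (sorted_list_of_multiset M) = size M" for M :: "nat multiset"
    by (metis mset_sorted_list_of_multiset size_mset)
  have \<phi>: "sorted_list_of_set (\<phi> M) = map (\<lambda>a. sorted_list_of_multiset M ! a + a) [0..<size M]" for M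
    unfolding \<phi>_def using sorted_padded_strict[of "sorted_list_of_multiset M"]
    by (intro sorted_list_of_set.idem_if_sorted_distinct) (simp_all add: strict_sorted_iff len del: set_map set_upt)
  have inj: "inj_on \<phi> I"
  proof (rule inj_onI)
    fix M N assume MN: "M \<in> I" "N \<in> I" "\<phi> M = \<phi> N"
    then have s: "size M = i" "size N = i" by (auto simp: I_def)
    have "map (\<lambda>a. sorted_list_of_multiset M ! a + a) [0..<i] = map (\<lambda>a. sorted_list_of_multiset N ! a + a) [0..<i]"
      using \<phi>[of M] \<phi>[of N] MN(3) s by simp
    then have "sorted_list_of_multiset M = sorted_list_of_multiset N"
      using s by (intro nth_equalityI) (auto simp: len)
    then show "M = N" by (metis mset_sorted_list_of_multiset)
  qed
  have "\<phi> ` I \<subseteq> J"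
  proof (rule image_subsetI)
    fix M assume "M \<in> I"
    then have M: "size M = i" "sum_mset M \<le> d" by (auto simp: I_def)
    let ?xs = "sorted_list_of_multiset M"
    have len: "length ?xs = i" using M len by simp
    have "card (\<phi> M) = length (sorted_list_of_set (\<phi> M))" by (simp add: \<phi>_def)
    also have "\<dots> = i" using \<phi>[of M] M by simp
    finally have c: "card (\<phi> M) = i" .
    have "\<Sum>(\<phi> M) = sum_list (sorted_list_of_set (\<phi> M))"
      using sum.distinct_set_conv_list[of "sorted_list_of_set (\<phi> M)" "\<lambda>x. x"] by (simp add: \<phi>_def)
    also have "\<dots> = (\<Sum>a<i. ?xs ! a + a)"
      using \<phi>[of M] M by (simp add: interv_sum_list_conv_sum_set_nat atLeast0LessThan)
    also have "\<dots> = (\<Sum>a<i. ?xs ! a) + \<Sum>{..<i}" by (simp add: sum.distrib)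
    also have "(\<Sum>a<i. ?xs ! a) = sum_list ?xs"
      using len by (simp add: sum_list_sum_nth atLeast0LessThan)
    also have "\<dots> = sum_mset M" by (metis mset_sorted_list_of_multiset sum_mset_sum_list)
    finally show "\<phi> M \<in> J" using c M by (simp add: J_def \<phi>_def)
  qed
  then have finI: "finite I" and card: "card I \<le> card J"
    using inj finJ by (blast intro: inj_on_finite card_inj_on_le)+
  define \<kappa> where "\<kappa> = (\<lambda>A::nat set. (!) (sorted_list_of_set A))"
  define P where "P = {p. p permutes {0..<i}}"
  have P_less: "p a < i" if "p \<in> P" "a < i" for p a
    using that permutes_in_image[of p "{0..<i}" a] by (simp add: P_def)
  define alt where "alt = (\<lambda>A (w::nat \<Rightarrow> 'a). det (mat i i (\<lambda>(a, s). w s ^ \<kappa> A a)))"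
  have alt: "alt A w = (\<Sum>p\<in>P. signof p * (\<Prod>l<i. w l ^ \<kappa> A (inv_into UNIV p l)))" for A w
  proof -
    have "alt A w = (\<Sum>p\<in>P. signof p * (\<Prod>l = 0..<i. w (p l) ^ \<kappa> A l))"
      unfolding alt_def by (subst det_def'[of _ i]) (auto intro!: sum.cong prod.cong simp: P_less P_def[symmetric])
    also have "\<dots> = (\<Sum>p\<in>P. signof p * (\<Prod>l<i. w l ^ \<kappa> A (inv_into UNIV p l)))"
    proof (intro sum.cong refl arg_cong2[where f = "(*)"])
      fix p assume "p \<in> P"
      then have p: "p permutes {..<i}" by (simp add: P_def atLeast0LessThan)
      have "(\<Prod>l<i. w l ^ \<kappa> A (inv_into UNIV p l)) = (\<Prod>l<i. w (p l) ^ \<kappa> A (inv_into UNIV p (p l)))"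
        by (rule prod.permute[OF p, unfolded o_def])
      then show "(\<Prod>l = 0..<i. w (p l) ^ \<kappa> A l) = (\<Prod>l<i. w l ^ \<kappa> A (inv_into UNIV p l))"
        using p by (simp add: permutes_inverses atLeast0LessThan)
    qed
    finally show ?thesis .
  qed
  have indep: "\<forall>A\<in>J. b A = 0" if b: "\<And>w. (\<Sum>A\<in>J. b A * alt A w) = 0" for b
  proof -
    have finP: "finite P" by (simp add: P_def finite_permutations)
    \<comment> \<open>All Leibniz terms of all alternants are distinct monomials: the set of
      exponents recovers \<open>A\<close>, their arrangement recovers \<open>p\<close>.\<close>
    have "\<forall>x\<in>J \<times> P. (case x of (A, p) \<Rightarrow> b A * signof p) = 0"
    proof (rule monomials_independent[where k = i and e = "\<lambda>(A, p) l. \<kappa> A (inv_into UNIV p l)"])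
      show "finite (J \<times> P)" using finJ finP by simp
    next
      fix w :: "nat \<Rightarrow> 'a"
      show "(\<Sum>x\<in>J \<times> P. (case x of (A, p) \<Rightarrow> b A * signof p) * (\<Prod>l<i. w l ^ (case x of (A, p) \<Rightarrow> \<lambda>l. \<kappa> A (inv_into UNIV p l)) l)) = 0"
        using b[of w] unfolding alt
        by (simp add: sum.cartesian_product case_prod_unfold sum_distrib_left mult.assoc)
    next
      fix x y assume xy: "x \<in> J \<times> P" "y \<in> J \<times> P"
        and eq: "\<And>l. l < i \<Longrightarrow> (case x of (A, p) \<Rightarrow> \<lambda>l. \<kappa> A (inv_into UNIV p l)) l = (case y of (A, p) \<Rightarrow> \<lambda>l. \<kappa> A (inv_into UNIV p l)) l"
      obtain A p B q where x: "x = (A, p)" "y = (B, q)" by fastforce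
      have A: "finite A" "card A = i" "finite B" "card B = i" using xy x by (auto simp: J_def)
      have p: "p permutes {..<i}" "q permutes {..<i}" using xy x by (auto simp: P_def atLeast0LessThan)
      have eq': "\<kappa> A (inv_into UNIV p l) = \<kappa> B (inv_into UNIV q l)" if "l < i" for l using eq[OF that] x by simp
      have im: "\<kappa> C ` {..<i} = C" if "finite C" "card C = i" for C
        using nth_image[of i "sorted_list_of_set C"] that by (simp add: \<kappa>_def atLeast0LessThan)
      have "A = \<kappa> A ` inv_into UNIV p ` {..<i}" using im A permutes_image[OF permutes_inv[OF p(1)]] by simp
      also have "\<dots> = \<kappa> B ` inv_into UNIV q ` {..<i}" using eq' by (auto simp: image_iff)
      also have "\<dots> = B" using im A permutes_image[OF permutes_inv[OF p(2)]] by simp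
      finally have AB: "A = B" .
      have "inv_into UNIV p l = inv_into UNIV q l" for l
      proof (cases "l < i")
        case True
        have "inv_into UNIV p l < i" "inv_into UNIV q l < i"
          using True permutes_in_image[OF permutes_inv[OF p(1)], of l] permutes_in_image[OF permutes_inv[OF p(2)], of l] by auto
        then show ?thesis using eq'[OF True] AB A
          by (simp add: \<kappa>_def nth_eq_iff_index_eq)
      next
        case False
        then show ?thesis using permutes_not_in[OF permutes_inv[OF p(1)], of l] permutes_not_in[OF permutes_inv[OF p(2)], of l] by simp
      qed
      then have "inv_into UNIV p = inv_into UNIV q" by blast
      then have "p = q" using p by (metis permutes_inv_inv)
      then show "x = y" using x AB by simp
    qed
    moreover have "id \<in> P" by (simp add: P_def permutes_id)
    ultimately have "b A * signof (id :: nat \<Rightarrow> nat) = 0" if "A \<in> J" for A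
      using that by (metis (no_types, lifting) SigmaI case_prod_conv)
    then show ?thesis by simp
  qed
  \<comment> \<open>\<open>N A p\<close> collects the indices in the Leibniz term of
    \<open>p\<close>. Terms with a negative index vanish, so only \<open>G A\<close> contributes,
    and there the truncated difference is exact.\<close>
  define N where "N = (\<lambda>A p. image_mset (\<lambda>a. \<kappa> A a - p a) (mset_set {..<i}))"
  define G where "G = (\<lambda>A. {p \<in> P. \<forall>a<i. p a \<le> \<kappa> A a})"
  define m where "m = (\<lambda>A M. \<Sum>p\<in>{p \<in> G A. N A p = M}. signof p :: 'a)"
  have NI: "N A p \<in> I" if A: "A \<in> J" and p: "p \<in> G A" for A p
  proof -
    have A': "finite A" "card A = i" "\<Sum>A \<le> d + \<Sum>{..<i}" using A by (auto simp: J_def)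
    have "(\<Sum>a<i. \<kappa> A a) = \<Sum>A"
    proof -
      have "(\<Sum>a<i. \<kappa> A a) = sum_list (sorted_list_of_set A)"
        using A' by (simp add: \<kappa>_def sum_list_sum_nth atLeast0LessThan)
      also have "\<dots> = \<Sum>A"
        using sum.distinct_set_conv_list[of "sorted_list_of_set A" "\<lambda>x. x"] A' by simp
      finally show ?thesis .
    qed
    moreover have "(\<Sum>a<i. \<kappa> A a) = (\<Sum>a<i. (\<kappa> A a - p a)) + (\<Sum>a<i. p a)"
      using p by (simp add: G_def sum.distrib[symmetric])
    moreover have "(\<Sum>a<i. p a) = \<Sum>{..<i}"
      using p sum.permute[of p "{..<i}" "\<lambda>x. x"] by (simp add: G_def P_def atLeast0LessThan)
    ultimately show ?thesis using A' by (simp add: I_def N_def sum_unfold_sum_mset)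
  qed
  have span: "alt A w = (\<Sum>M\<in>I. m A M * (D w * (\<Prod>x\<in>#M. h w x)))" if A: "A \<in> J" for A w
  proof -
    have finG: "finite (G A)" by (simp add: G_def P_def finite_permutations)
    have "det (mat i i (\<lambda>(a, b). if b \<le> \<kappa> A a then h w (\<kappa> A a - b) else 0)) =
        (\<Sum>p\<in>P. signof p * (\<Prod>a<i. if p a \<le> \<kappa> A a then h w (\<kappa> A a - p a) else 0))"
      by (subst det_def'[of _ i]) (auto intro!: sum.cong prod.cong simp: P_less P_def atLeast0LessThan)
    also have "\<dots> = (\<Sum>p\<in>G A. signof p * (\<Prod>a<i. if p a \<le> \<kappa> A a then h w (\<kappa> A a - p a) else 0))"
      by (rule sum.mono_neutral_right) (auto simp: G_def P_def finite_permutations intro!: prod_zero)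
    also have "\<dots> = (\<Sum>p\<in>G A. signof p * (\<Prod>x\<in>#N A p. h w x))"
      by (intro sum.cong refl arg_cong2[where f = "(*)"])
        (simp add: N_def G_def prod_unfold_prod_mset image_mset.compositionality o_def)
    also have "\<dots> = (\<Sum>M\<in>I. \<Sum>p\<in>{p \<in> G A. N A p = M}. signof p * (\<Prod>x\<in>#N A p. h w x))"
      using NI[OF A] by (intro sum.group[symmetric] finG finI) auto
    also have "\<dots> = (\<Sum>M\<in>I. m A M * (\<Prod>x\<in>#M. h w x))"
      by (intro sum.cong refl) (simp add: m_def sum_distrib_right)
    finally show ?thesis unfolding alt_def det_powers_eq D_def h_def by (simp add: sum_distrib_left sum_distrib_right mult_ac)
  qed
  have MI: "\<M> \<subseteq> I"
  proof
    fix M assume "M \<in> \<M>"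
    then have "sum_mset M \<le> d" unfolding d_def by (intro member_le_sum fin) auto
    then show "M \<in> I" using size \<open>M \<in> \<M>\<close> by (simp add: I_def)
  qed
  define a' where "a' = (\<lambda>M. if M \<in> \<M> then a M else 0)"
  have zero': "(\<Sum>M\<in>I. a' M * (D w * (\<Prod>x\<in>#M. h w x))) = 0" for w
  proof -
    have "(\<Sum>M\<in>I. a' M * (D w * (\<Prod>x\<in>#M. h w x))) = (\<Sum>M\<in>\<M>. a M * (D w * (\<Prod>x\<in>#M. h w x)))"
      using MI finI by (intro sum.mono_neutral_cong_right) (auto simp: a'_def)
    also have "\<dots> = D w * (\<Sum>M\<in>\<M>. a M * (\<Prod>x\<in>#M. h w x))"
      by (simp add: sum_distrib_left mult_ac)
    finally show ?thesis using zero[of w] by (simp add: h_def)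
  qed
  have "\<forall>M\<in>I. a' M = 0"
    by (rule independent_by_counting[OF finI finJ card, where u = alt and m = m and v = "\<lambda>M w. D w * (\<Prod>x\<in>#M. h w x)"])
      (use indep span zero' in auto)
  then have "\<forall>M\<in>\<M>. a' M = 0" using MI by blast
  then show ?thesis by (simp add: a'_def)
qed

section \<open>Power sums of the roots of a polynomial split into even and odd part\<close>

text \<open>The \<open>\<xi> v\<close> are the negated reciprocals of the roots, padded with zeros.
  The constant term \<open>1\<close> excludes the root \<open>0\<close> and fixes the scalar
  factor.\<close>

lemma poly_as_product:
  fixes N :: "'k::alg_closed_field poly"
  assumes "coeff N 0 = 1" "degree N \<le> n"
  shows "\<exists>\<xi>. (\<Prod>v<n. [:1, \<xi> v:]) = N"
proof -
  have "N \<noteq> 0" using assms(1) by auto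
  from alg_closed_imp_factorization[OF this] obtain A where A: "size A = degree N"
    "N = Polynomial.smult (lead_coeff N) (\<Prod>x\<in>#A. [:- x, 1:])" by blast
  obtain xs where xs: "mset xs = A" using ex_mset by blast
  define d where "d = length xs"
  have d: "d \<le> n" using A(1) xs assms(2) unfolding d_def by (metis size_mset)
  have "(\<Prod>x\<in>#A. [:- x, 1:]) = prod_list (map (\<lambda>x. [:- x, 1:]) xs)"
    by (simp add: xs[symmetric] prod_mset_prod_list flip: mset_map)
  also have "\<dots> = (\<Prod>v<d. [:- (xs ! v), 1:])"
    by (simp add: prod.list_conv_set_nth d_def atLeast0LessThan)
  finally have N: "N = Polynomial.smult (lead_coeff N) (\<Prod>v<d. [:- (xs ! v), 1:])" using A(2) by simp
  have one: "lead_coeff N * (\<Prod>v<d. - (xs ! v)) = 1"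
    using arg_cong[OF N, of "\<lambda>p. poly p 0"] assms(1)[folded poly_0_coeff_0]
    by (simp add: poly_prod del: poly_0_coeff_0)
  have nz: "xs ! v \<noteq> 0" if "v < d" for v
  proof
    assume "xs ! v = 0"
    then have "(\<Prod>v<d. - (xs ! v)) = 0" using that by (intro prod_zero) auto
    then have "lead_coeff N * (\<Prod>v<d. - (xs ! v)) = 0" by (simp only: mult_zero_right)
    with one show False by simp
  qed
  have "(\<Prod>v<d. [:- (xs ! v), 1:]) = (\<Prod>v<d. [:- (xs ! v):] * [:1, - 1 / xs ! v:])"
    using nz by (intro prod.cong) auto
  also have "\<dots> = [:\<Prod>v<d. - (xs ! v):] * (\<Prod>v<d. [:1, - 1 / xs ! v:])"
  proof -
    have "(\<Prod>v<e. [:f v:]) = [:\<Prod>v<e. f v:]" for e :: nat and f :: "nat \<Rightarrow> 'k"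
      by (induction e) (simp_all add: mult.commute)
    then show ?thesis by (simp only: prod.distrib)
  qed
  finally have N': "N = (\<Prod>v<d. [:1, - 1 / xs ! v:])"
    using N one by simp
  define \<xi> where "\<xi> = (\<lambda>v. if v < d then - 1 / xs ! v else 0)"
  have "(\<Prod>v<n. [:1, \<xi> v:]) = (\<Prod>v<d. [:1, - 1 / xs ! v:])"
    using d by (intro prod.mono_neutral_cong_right) (auto simp: \<xi>_def one_pCons)
  then show ?thesis using N' by blast
qed

text \<open>Logarithmic derivative without denominators: each factor contributes
  \<open>\<xi> v / (1 + \<xi> v * z)\<close>, whose expansion yields power sums with alternating
  signs.\<close>

lemma fps_deriv_product:
  fixes \<xi> :: "nat \<Rightarrow> 'k::field"
  shows "fps_deriv (fps_of_poly (\<Prod>v<n. [:1, \<xi> v:])) =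
    fps_of_poly (\<Prod>v<n. [:1, \<xi> v:]) * Abs_fps (\<lambda>k. \<Sum>v<n. \<xi> v * (- \<xi> v) ^ k)"
proof (induction n)
  case 0
  show ?case by (simp add: fps_eq_iff)
next
  case (Suc n)
  let ?N = "fps_of_poly (\<Prod>v<n. [:1, \<xi> v:])" and ?G = "Abs_fps (\<lambda>k. \<Sum>v<n. \<xi> v * (- \<xi> v) ^ k)"
  let ?g = "Abs_fps (\<lambda>k. \<xi> n * (- \<xi> n) ^ k)"
  have lin: "fps_of_poly [:1, \<xi> n:] = 1 + fps_const (\<xi> n) * fps_X"
    by (rule fps_ext) (auto simp: fps_of_poly_nth coeff_pCons split: nat.splits)
  have g: "(1 + fps_const (\<xi> n) * fps_X) * ?g = fps_const (\<xi> n)"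
  proof (rule fps_ext)
    fix k
    show "fps_nth ((1 + fps_const (\<xi> n) * fps_X) * ?g) k = fps_nth (fps_const (\<xi> n)) k"
      by (cases k) (simp_all add: distrib_right mult.assoc)
  qed
  have sum: "Abs_fps (\<lambda>k. \<Sum>v<Suc n. \<xi> v * (- \<xi> v) ^ k) = ?G + ?g" by (rule fps_ext) simp
  have "fps_deriv (?N * (1 + fps_const (\<xi> n) * fps_X)) =
      ?N * (1 + fps_const (\<xi> n) * fps_X) * ?G + ?N * fps_const (\<xi> n)"
    by (simp add: Suc algebra_simps)
  also have "?N * fps_const (\<xi> n) = ?N * ((1 + fps_const (\<xi> n) * fps_X) * ?g)" by (simp only: g)
  finally have step: "fps_deriv (?N * (1 + fps_const (\<xi> n) * fps_X)) = ?N * (1 + fps_const (\<xi> n) * fps_X) * (?G + ?g)"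
    unfolding distrib_left[of "?N * (1 + fps_const (\<xi> n) * fps_X)"] by (simp only: mult.assoc)
  have "fps_of_poly (\<Prod>v<Suc n. [:1, \<xi> v:]) = ?N * (1 + fps_const (\<xi> n) * fps_X)"
    by (simp only: prod.lessThan_Suc fps_of_poly_mult lin)
  with step show ?case by (simp only: sum)
qed

text \<open>The difference of the logarithmic derivatives of the two products is twice the
  generating function of the odd power sums, and it depends only on the ratio
  \<open>c * \<tau>\<close> of odd to even part. The conclusion is the derivative of artanh of
  \<open>c * \<tau>\<close>, cleared of its denominator.\<close>

lemma odd_power_sums_eq:
  fixes E \<tau> :: "'k::field_char_0 fps" and \<xi> :: "nat \<Rightarrow> 'k"
  assumes plus: "fps_of_poly (\<Prod>v<n. [:1, \<xi> v:]) = E + fps_const c * (E * \<tau>)"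
    and minus: "fps_of_poly (\<Prod>v<n. [:1, - \<xi> v:]) = E - fps_const c * (E * \<tau>)"
    and E0: "fps_nth E 0 \<noteq> 0"
  defines "P \<equiv> Abs_fps (\<lambda>m. if even m then \<Sum>v<n. \<xi> v ^ (m + 1) else 0)"
  shows "P * (1 - (fps_const c * \<tau>)\<^sup>2) = fps_const c * fps_deriv \<tau>"
proof -
  define H where "H = fps_const c * (E * \<tau>)"
  define G where "G = (\<lambda>\<xi>. Abs_fps (\<lambda>k. \<Sum>v<n. \<xi> v * (- \<xi> v) ^ k) :: 'k fps)"
  have d1: "fps_deriv (E + H) = (E + H) * G \<xi>"
    using fps_deriv_product[of \<xi> n] unfolding plus H_def G_def .
  have d2: "fps_deriv (E - H) = (E - H) * G (\<lambda>v. - \<xi> v)"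
    using fps_deriv_product[of "\<lambda>v. - \<xi> v" n] unfolding minus H_def G_def .
  have "G \<xi> - G (\<lambda>v. - \<xi> v) = P + P"
  proof (rule fps_ext)
    fix m
    have "\<xi> v * (- \<xi> v) ^ m + \<xi> v * \<xi> v ^ m = (if even m then 2 * \<xi> v ^ (m + 1) else 0)" for v
      by (auto simp: uminus_power_if)
    then have "(\<Sum>v<n. \<xi> v * (- \<xi> v) ^ m) + (\<Sum>v<n. \<xi> v * \<xi> v ^ m) = (if even m then 2 * (\<Sum>v<n. \<xi> v ^ (m + 1)) else 0)"
      unfolding sum.distrib[symmetric] by (simp add: sum_distrib_left)
    then show "fps_nth (G \<xi> - G (\<lambda>v. - \<xi> v)) m = fps_nth (P + P) m"
      by (simp only: fps_add_nth) (simp add: G_def P_def sum_negf)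
  qed
  then have G: "G \<xi> = G (\<lambda>v. - \<xi> v) + (P + P)" by (simp only: diff_eq_eq add.commute)
  have "(P + P) * ((E + H) * (E - H)) = (E + H) * G \<xi> * (E - H) - (E - H) * G (\<lambda>v. - \<xi> v) * (E + H)"
    unfolding G by (simp add: algebra_simps)
  also have "\<dots> = fps_deriv (E + H) * (E - H) - fps_deriv (E - H) * (E + H)"
    by (simp only: d1 d2)
  also have "\<dots> = 2 * (fps_deriv H * E - fps_deriv E * H)" by (simp add: algebra_simps)
  finally have "2 * (P * ((E + H) * (E - H))) = 2 * (fps_deriv H * E - fps_deriv E * H)"
    by (simp only: mult_2 distrib_right)
  moreover have "(2 :: 'k fps) \<noteq> 0"
  proof
    assume "(2 :: 'k fps) = 0"
    then have "fps_nth (2 :: 'k fps) 0 = 0" by (simp only: fps_zero_nth)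
    then show False by (simp add: fps_numeral_nth)
  qed
  ultimately have "P * ((E + H) * (E - H)) = fps_deriv H * E - fps_deriv E * H"
    by (simp only: mult_cancel_left simp_thms)
  also have "\<dots> = E\<^sup>2 * (fps_const c * fps_deriv \<tau>)"
    by (simp add: H_def power2_eq_square algebra_simps)
  finally have "E\<^sup>2 * (P * (1 - (fps_const c * \<tau>)\<^sup>2)) = E\<^sup>2 * (fps_const c * fps_deriv \<tau>)"
    by (simp add: H_def power2_eq_square algebra_simps)
  moreover have "E\<^sup>2 \<noteq> 0" using E0 by auto
  ultimately show ?thesis by (metis mult_cancel_left)
qed

text \<open>Truncation of the geometric series solving \<open>P * (1 - (c * \<tau>)\<^sup>2) = c * \<tau>'\<close>, as a polynomial in \<open>c\<close>.\<close>

definition psum_poly :: "'k::field fps \<Rightarrow> nat \<Rightarrow> 'k poly" where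
  "psum_poly \<tau> m = (\<Sum>r<Suc m. Polynomial.monom (fps_nth (fps_deriv \<tau> * \<tau> ^ (2 * r)) m) (2 * r))"

lemma psum_poly_0: "poly (psum_poly \<tau> m) 0 = of_nat (m + 1) * fps_nth \<tau> (m + 1)"
proof -
  have "poly (psum_poly \<tau> m) 0 = (\<Sum>r<Suc m. if r = 0 then fps_nth (fps_deriv \<tau>) m else 0)"
    unfolding psum_poly_def poly_sum by (intro sum.cong) (auto simp: poly_monom)
  then show ?thesis by simp
qed

text \<open>As \<open>\<tau>\<close> has no constant term, \<open>Y ^ Suc m\<close> starts beyond
  degree \<open>m\<close>, so the truncated geometric series gives coefficient \<open>m\<close>
  exactly.\<close>

lemma fps_nth_eq_psum_poly:
  assumes P: "P * (1 - (fps_const c * \<tau>)\<^sup>2) = fps_const c * fps_deriv \<tau>" and "fps_nth \<tau> 0 = 0"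
  shows "fps_nth P m = c * poly (psum_poly \<tau> m) c"
proof -
  define Y where "Y = (fps_const c * \<tau>)\<^sup>2"
  have Y0: "fps_nth Y 0 = 0" using assms(2) by (simp add: Y_def power2_eq_square)
  have "P * (1 - Y ^ Suc m) = P * (1 - Y) * (\<Sum>r<Suc m. Y ^ r)"
    by (simp only: one_diff_power_eq mult.assoc)
  also have "P * (1 - Y) = fps_const c * fps_deriv \<tau>" using P by (simp add: Y_def)
  finally have "P = fps_const c * (\<Sum>r<Suc m. fps_deriv \<tau> * Y ^ r) + P * Y ^ Suc m"
    by (simp only: algebra_simps sum_distrib_left) (simp add: algebra_simps)
  then have "fps_nth P m = fps_nth (fps_const c * (\<Sum>r<Suc m. fps_deriv \<tau> * Y ^ r)) m + fps_nth (P * Y ^ Suc m) m"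
    by (metis fps_add_nth)
  also have "fps_nth (P * Y ^ Suc m) m = 0"
    using startsby_zero_power_prefix[OF Y0, of "Suc m"] by (simp add: fps_mult_nth del: power_Suc)
  also have "fps_nth (fps_const c * (\<Sum>r<Suc m. fps_deriv \<tau> * Y ^ r)) m = c * poly (psum_poly \<tau> m) c"
  proof -
    have "Y ^ r = fps_const (c ^ (2 * r)) * \<tau> ^ (2 * r)" for r
      by (simp add: Y_def power_mult_distrib fps_const_power power_mult flip: power_mult)
    then have "fps_deriv \<tau> * Y ^ r = fps_const (c ^ (2 * r)) * (fps_deriv \<tau> * \<tau> ^ (2 * r))" for r
      by (simp add: mult_ac)
    then have "fps_nth (fps_deriv \<tau> * Y ^ r) m = fps_nth (fps_deriv \<tau> * \<tau> ^ (2 * r)) m * c ^ (2 * r)" for r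
      by (simp only: fps_mult_left_const_nth mult.commute[of "c ^ (2 * r)"])
    then show ?thesis by (simp add: psum_poly_def poly_sum poly_monom fps_sum_nth del: sum.lessThan_Suc)
  qed
  finally show ?thesis by simp
qed

text \<open>
  The power series with initial coefficients \<open>t 0, \<dots>, t j\<close> whose product with
  \<open>\<Prod> (1 - w s * y)\<close> is a polynomial of degree at most \<open>j\<close>.
\<close>

definition quot_series :: "nat \<Rightarrow> nat \<Rightarrow> (nat \<Rightarrow> 'k::field) \<Rightarrow> (nat \<Rightarrow> 'k) \<Rightarrow> 'k fps" where
  "quot_series i j w t = (let E = fps_of_poly (\<Prod>s<i. [:1, - w s:])
     in inverse E * fps_cutoff (Suc j) (E * Abs_fps t))"

lemma coeff_0_linear_prod [simp]: "coeff (\<Prod>s<i. [:1, f s:]) 0 = (1 :: 'k::field)"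
  by (simp add: poly_0_coeff_0[symmetric] poly_prod)

lemma quot_series_low:
  assumes "l \<le> j"
  shows "fps_nth (quot_series i j w t) l = t l"
proof -
  define E where "E = fps_of_poly (\<Prod>s<i. [:1, - w s:])"
  have "fps_nth (inverse E * fps_cutoff (Suc j) (E * Abs_fps t)) l = fps_nth (inverse E * (E * Abs_fps t)) l"
    unfolding fps_mult_nth[of "inverse E"] using assms by (intro sum.cong) auto
  also have "inverse E * (E * Abs_fps t) = Abs_fps t"
    using inverse_mult_eq_1[of E] by (simp add: E_def flip: mult.assoc)
  finally show ?thesis by (simp add: quot_series_def E_def Let_def)
qed

text \<open>Along a line of parameters the coefficients are affine in \<open>\<epsilon>\<close>, so
  relations between them become polynomial identities in \<open>\<epsilon>\<close>.\<close>

lemma quot_series_linear: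
  "quot_series i j w (\<lambda>l. t l + \<epsilon> * s l) = quot_series i j w t + fps_const \<epsilon> * quot_series i j w s"
proof -
  have "Abs_fps (\<lambda>l. t l + \<epsilon> * s l) = Abs_fps t + fps_const \<epsilon> * Abs_fps s" by (rule fps_ext) simp
  moreover have "fps_cutoff k (f + fps_const \<epsilon> * g) = fps_cutoff k f + fps_const \<epsilon> * fps_cutoff k g" for k and f g :: "'a fps"
    by (rule fps_ext) simp
  ultimately show ?thesis by (simp add: quot_series_def Let_def distrib_left mult.left_commute[of _ "fps_const \<epsilon>"])
qed

text \<open>As \<open>E\<close> has constant term \<open>1\<close>, the cutoff of
  \<open>E * fps_X ^ j\<close> is \<open>fps_X ^ j\<close>, and the series is
  \<open>fps_X ^ j\<close> divided by \<open>E\<close>.\<close>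

lemma quot_series_unit:
  "fps_nth (quot_series i j w (\<lambda>l. if l = j then 1 else 0)) (j + k) = complete_sym i w k"
proof -
  define E where "E = fps_of_poly (\<Prod>s<i. [:1, - w s:])"
  have u: "Abs_fps (\<lambda>l. if l = j then 1 else 0) = (fps_X ^ j :: 'a fps)" by (rule fps_ext) simp
  have "fps_cutoff (Suc j) (E * fps_X ^ j) = fps_X ^ j"
    by (rule fps_ext) (auto simp: fps_X_power_mult_right_nth E_def not_less less_Suc_eq)
  then show ?thesis
    by (simp add: quot_series_def Let_def u complete_sym_def fps_X_power_mult_right_nth flip: E_def)
qed

text \<open>Replacing \<open>z\<close> by \<open>- z\<close> in \<open>N\<close> flips the sign of
  its odd part only, which supplies both hypotheses of \<open>odd_power_sums_eq\<close>. Coefficient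
  \<open>2 * k\<close> there belongs to the power sum of exponent \<open>2 * k + 1\<close>.\<close>

lemma odd_power_sums_realizable:
  fixes w t :: "nat \<Rightarrow> 'k::{alg_closed_field, field_char_0}"
  assumes "2 * i \<le> n" "2 * j + 1 \<le> n"
  defines "\<tau> \<equiv> fps_X * (quot_series i j w t oo fps_X\<^sup>2)"
  shows "\<exists>\<xi>. \<forall>k. (\<Sum>v<n. \<xi> v ^ (2 * k + 1)) = c * poly (psum_poly \<tau> (2 * k)) c"
proof -
  define Q where "Q = (\<Prod>s<i. [:1, - w s:])"
  \<comment> \<open>This is the polynomial \<open>Q * quot_series i j w t\<close>; the cutoff in the
    series bounds its degree by \<open>j\<close>.\<close>
  define R where "R = (\<Sum>l\<le>j. Polynomial.monom (fps_nth (fps_of_poly Q * Abs_fps t) l) l)"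
  define sq :: "'k poly" where "sq = [:0, 0, 1:]"
  define N where "N = Q \<circ>\<^sub>p sq + Polynomial.smult c ([:0, 1:] * (R \<circ>\<^sub>p sq))"
  have sq: "fps_of_poly sq = fps_X\<^sup>2"
    by (rule fps_ext) (auto simp: sq_def fps_of_poly_nth coeff_pCons split: nat.splits)
  have "degree Q \<le> i"
  proof -
    have "degree Q \<le> (\<Sum>s<i. degree [:1, - w s:])"
      unfolding Q_def by (rule order.trans[OF degree_prod_sum_le]) simp_all
    also have "\<dots> \<le> (\<Sum>s<i. 1)" by (intro sum_mono) simp
    finally show ?thesis by simp
  qed
  then have d1: "degree (Q \<circ>\<^sub>p sq) \<le> n" using assms(1) by (simp add: sq_def degree_pcompose)
  have "degree R \<le> j" unfolding R_def by (intro degree_sum_le) (auto intro: order.trans[OF degree_monom_le])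
  then have "degree ([:0, 1:] * (R \<circ>\<^sub>p sq)) \<le> n"
    using assms(2) degree_mult_le[of "[:0, 1:]" "R \<circ>\<^sub>p sq"]
    by (simp add: sq_def degree_pcompose split: if_splits)
  then have d2: "degree (Polynomial.smult c ([:0, 1:] * (R \<circ>\<^sub>p sq))) \<le> n"
    using degree_smult_le order.trans by blast
  have "coeff N 0 = 1"
    unfolding N_def by (simp add: poly_0_coeff_0[symmetric] poly_pcompose sq_def Q_def poly_prod)
  from poly_as_product[OF this] obtain \<xi> where \<xi>: "(\<Prod>v<n. [:1, \<xi> v:]) = N"
    using degree_add_le[OF d1 d2] unfolding N_def by blast
  have neg: "(\<Prod>v<n. [:1, - \<xi> v:]) = Q \<circ>\<^sub>p sq - Polynomial.smult c ([:0, 1:] * (R \<circ>\<^sub>p sq))"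
  proof -
    have "(\<Prod>v<n. [:1, - \<xi> v:]) = N \<circ>\<^sub>p [:0, - 1:]"
      unfolding \<xi>[symmetric] by (simp add: pcompose_prod pcompose_pCons)
    also have "\<dots> = Q \<circ>\<^sub>p (sq \<circ>\<^sub>p [:0, - 1:]) + Polynomial.smult c ([:0, - 1:] * (R \<circ>\<^sub>p (sq \<circ>\<^sub>p [:0, - 1:])))"
      by (simp add: N_def pcompose_add pcompose_smult pcompose_mult pcompose_assoc pcompose_pCons)
    also have "sq \<circ>\<^sub>p [:0, - 1:] = sq" by (simp add: sq_def pcompose_pCons)
    finally show ?thesis by simp
  qed
  define E where "E = fps_of_poly Q oo fps_X\<^sup>2"
  have R: "fps_of_poly R = fps_of_poly Q * quot_series i j w t"
  proof -
    have "fps_of_poly R = fps_cutoff (Suc j) (fps_of_poly Q * Abs_fps t)"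
      by (rule fps_ext) (auto simp: R_def fps_of_poly_nth coeff_sum)
    also have "\<dots> = fps_of_poly Q * quot_series i j w t"
      using inverse_mult_eq_1'[of "fps_of_poly Q"] by (simp add: quot_series_def Q_def Let_def flip: mult.assoc)
    finally show ?thesis .
  qed
  have X: "fps_of_poly [:0, 1:] = (fps_X :: 'k fps)"
    by (rule fps_ext) (auto simp: fps_of_poly_nth coeff_pCons split: nat.splits)
  have EO: "fps_of_poly (Q \<circ>\<^sub>p sq) = E" "fps_of_poly ([:0, 1:] * (R \<circ>\<^sub>p sq)) = E * \<tau>"
  proof -
    have c: "fps_of_poly (p \<circ>\<^sub>p sq) = fps_of_poly p oo fps_X\<^sup>2" for p
      using fps_of_poly_pcompose[of sq p] unfolding sq by (simp add: sq_def)
    show "fps_of_poly (Q \<circ>\<^sub>p sq) = E" by (simp add: c E_def)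
    have "fps_of_poly ([:0, 1:] * (R \<circ>\<^sub>p sq)) = fps_X * ((fps_of_poly Q * quot_series i j w t) oo fps_X\<^sup>2)"
      unfolding fps_of_poly_mult X c R ..
    also have "\<dots> = E * \<tau>"
      by (subst fps_compose_mult_distrib) (simp_all add: E_def \<tau>_def mult_ac)
    finally show "fps_of_poly ([:0, 1:] * (R \<circ>\<^sub>p sq)) = E * \<tau>" .
  qed
  have "fps_nth E 0 \<noteq> 0" by (simp add: E_def Q_def)
  from odd_power_sums_eq[OF _ _ this, where n = n and \<xi> = \<xi> and c = c and \<tau> = \<tau>]
  have "Abs_fps (\<lambda>m. if even m then \<Sum>v<n. \<xi> v ^ (m + 1) else 0) * (1 - (fps_const c * \<tau>)\<^sup>2) = fps_const c * fps_deriv \<tau>"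
    unfolding \<xi> neg N_def by (simp only: fps_of_poly_add fps_of_poly_diff fps_of_poly_smult EO)
  from fps_nth_eq_psum_poly[OF this, of "2 * _"]
  have "(\<Sum>v<n. \<xi> v ^ (2 * k + 1)) = c * poly (psum_poly \<tau> (2 * k)) c" for k
    by (simp add: \<tau>_def)
  then show ?thesis by blast
qed

lemma psum_poly_quot_series_0:
  "poly (psum_poly (fps_X * (quot_series i j w t oo fps_X\<^sup>2)) (2 * k)) 0 =
    of_nat (2 * k + 1) * fps_nth (quot_series i j w t) k"
  by (simp add: psum_poly_0 fps_nth_compose_X_power)

text \<open>Independence at \<open>0\<close> lifts to polynomial coefficients: divide a relation by
  the common power of the variable, evaluate at \<open>0\<close>, and every quotient turns out to
  have one more factor. Only zero is divisible by all powers.\<close>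

lemma lowest_order_vanishes:
  fixes A :: "'m \<Rightarrow> 'k::field poly" and g :: "'w \<Rightarrow> 'm \<Rightarrow> 'k poly"
  assumes zero: "\<And>w. (\<Sum>M\<in>\<M>. A M * g w M) = 0"
    and indep: "\<And>b. (\<And>w. (\<Sum>M\<in>\<M>. b M * poly (g w M) 0) = 0) \<Longrightarrow> \<forall>M\<in>\<M>. b M = 0"
    and M: "M \<in> \<M>"
  shows "A M = 0"
proof -
  have "\<exists>B. \<forall>M\<in>\<M>. A M = [:0, 1:] ^ q * B M" for q
  proof (induction q)
    case 0
    show ?case by (intro exI[of _ A]) simp
  next
    case (Suc q)
    then obtain B where B: "\<And>M. M \<in> \<M> \<Longrightarrow> A M = [:0, 1:] ^ q * B M" by blast
    have "[:0, 1:] ^ q * (\<Sum>M\<in>\<M>. B M * g w M) = (\<Sum>M\<in>\<M>. A M * g w M)" for w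
      unfolding sum_distrib_left by (intro sum.cong) (simp_all add: B)
    then have "[:0, 1:] ^ q * (\<Sum>M\<in>\<M>. B M * g w M) = 0" for w by (simp only: zero)
    then have "(\<Sum>M\<in>\<M>. B M * g w M) = 0" for w by simp
    then have "poly (\<Sum>M\<in>\<M>. B M * g w M) 0 = 0" for w by simp
    then have "\<forall>M\<in>\<M>. poly (B M) 0 = 0"
      by (intro indep) (simp add: poly_sum)
    then have "\<forall>M\<in>\<M>. \<exists>C. B M = [:0, 1:] * C" by (auto simp: poly_eq_0_iff_dvd dvd_def)
    then obtain C where "\<forall>M\<in>\<M>. B M = [:0, 1:] * C M" by metis
    then show ?case using B by (intro exI[of _ C]) (simp add: mult.assoc mult.left_commute)
  qed
  then obtain B where B: "A M = [:0, 1:] ^ Suc (degree (A M)) * B M" using M by metis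
  show ?thesis
  proof (rule ccontr)
    assume "A M \<noteq> 0"
    then have "B M \<noteq> 0" using B by auto
    then have "degree (A M) = Suc (degree (A M)) + degree (B M)"
      by (subst B) (simp add: degree_mult_eq degree_power_eq del: power_Suc)
    then show False by simp
  qed
qed

section \<open>Evaluation of polynomials and the algebra of supersymmetric polynomials\<close>

abbreviation "lk \<equiv> Poly_Mapping.lookup"

definition monom_eval :: "(nat \<Rightarrow> 'b::comm_monoid_mult) \<Rightarrow> (nat \<Rightarrow>\<^sub>0 nat) \<Rightarrow> 'b" where
  "monom_eval \<sigma> m = (\<Prod>v\<in>Poly_Mapping.keys m. \<sigma> v ^ lk m v)"

definition mpoly_eval :: "('a::zero \<Rightarrow> 'b::comm_semiring_1) \<Rightarrow> (nat \<Rightarrow> 'b) \<Rightarrow> 'a mpoly \<Rightarrow> 'b" where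
  "mpoly_eval f \<sigma> p = (\<Sum>m\<in>Poly_Mapping.keys p. f (lk p m) * monom_eval \<sigma> m)"

lemma monom_eval_superset:
  assumes "finite V" "Poly_Mapping.keys m \<subseteq> V"
  shows "monom_eval \<sigma> m = (\<Prod>v\<in>V. \<sigma> v ^ lk m v)"
  unfolding monom_eval_def using assms
  by (intro prod.mono_neutral_left) (auto simp: in_keys_iff)

lemma monom_eval_0 [simp]: "monom_eval \<sigma> 0 = 1"
  by (simp add: monom_eval_def)

lemma monom_eval_add: "monom_eval \<sigma> (m + m') = monom_eval \<sigma> m * monom_eval \<sigma> m'"
proof -
  let ?V = "Poly_Mapping.keys m \<union> Poly_Mapping.keys m'"
  have "Poly_Mapping.keys (m + m') \<subseteq> ?V" by (rule keys_add)
  then show ?thesis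
    by (simp add: monom_eval_superset[of ?V] lookup_add power_add prod.distrib)
qed

text \<open>Serves both \<open>Const\<close>, which yields \<open>subst\<close>, and the embedding
  into an algebraic closure, where relations are evaluated at numbers.\<close>

locale coeff_hom =
  fixes f :: "'a::comm_ring_1 \<Rightarrow> 'b::comm_ring_1"
  assumes f_add: "f (x + y) = f x + f y" and f_mult: "f (x * y) = f x * f y"
    and f_0: "f 0 = 0" and f_1: "f 1 = 1"
begin

lemma eval_superset:
  assumes "finite A" "Poly_Mapping.keys p \<subseteq> A"
  shows "mpoly_eval f \<sigma> p = (\<Sum>m\<in>A. f (lk p m) * monom_eval \<sigma> m)"
  unfolding mpoly_eval_def using assms
  by (intro sum.mono_neutral_left) (auto simp: in_keys_iff f_0)

lemma eval_add: "mpoly_eval f \<sigma> (p + q) = mpoly_eval f \<sigma> p + mpoly_eval f \<sigma> q"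
proof -
  let ?A = "Poly_Mapping.keys p \<union> Poly_Mapping.keys q"
  have "Poly_Mapping.keys (p + q) \<subseteq> ?A" by (rule keys_add)
  then show ?thesis
    by (simp add: eval_superset[of ?A] lookup_add f_add distrib_right sum.distrib)
qed

lemma eval_0 [simp]: "mpoly_eval f \<sigma> 0 = 0"
  by (simp add: mpoly_eval_def)

lemma eval_single: "mpoly_eval f \<sigma> (Poly_Mapping.single m c) = f c * monom_eval \<sigma> m"
  by (simp add: eval_superset[of "{m}"])

lemma eval_sum: "mpoly_eval f \<sigma> (\<Sum>x\<in>A. p x) = (\<Sum>x\<in>A. mpoly_eval f \<sigma> (p x))"
  by (induction A rule: infinite_finite_induct) (simp_all add: eval_add)

end

lemma mpoly_expand:
  fixes p :: "'a::comm_monoid_add mpoly"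
  shows "p = (\<Sum>m\<in>Poly_Mapping.keys p. Poly_Mapping.single m (lk p m))"
  by (rule poly_mapping_eqI) (simp add: lookup_sum lookup_single when_def in_keys_iff)

lemma mpoly_induct [case_names single add]:
  fixes p :: "'a::comm_monoid_add mpoly"
  assumes "\<And>m c. P (Poly_Mapping.single m c)" and "\<And>p q. P p \<Longrightarrow> P q \<Longrightarrow> P (p + q)"
  shows "P p"
proof -
  have "P (\<Sum>m\<in>A. Poly_Mapping.single m (lk p m))" if "finite A" for A
    using that
  proof (induction A)
    case empty
    show ?case using assms(1)[of undefined 0] by simp
  qed (simp add: assms)
  then show ?thesis by (subst mpoly_expand) simp
qed

context coeff_hom
begin

lemma eval_mult: "mpoly_eval f \<sigma> (p * q) = mpoly_eval f \<sigma> p * mpoly_eval f \<sigma> q"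
proof (induction p rule: mpoly_induct)
  case (single m c)
  show ?case
  proof (induction q rule: mpoly_induct)
    case (single m' c')
    show ?case by (simp add: mult_single eval_single f_mult monom_eval_add)
  qed (simp add: distrib_left eval_add)
qed (simp add: distrib_right eval_add)

lemma eval_Const: "mpoly_eval f \<sigma> (Const c) = f c"
  by (simp add: Const_def eval_single)

lemma eval_Var: "mpoly_eval f \<sigma> (Var v) = \<sigma> v"
  by (simp add: Var_def eval_single f_1 monom_eval_def)

lemma eval_1: "mpoly_eval f \<sigma> 1 = 1"
  using eval_Const[of \<sigma> 1] by (simp add: Const_def f_1)

lemma eval_power: "mpoly_eval f \<sigma> (p ^ k) = mpoly_eval f \<sigma> p ^ k"
  by (induction k) (simp_all add: eval_1 eval_mult)

lemma eval_prod: "mpoly_eval f \<sigma> (\<Prod>x\<in>A. p x) = (\<Prod>x\<in>A. mpoly_eval f \<sigma> (p x))"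
  by (induction A rule: infinite_finite_induct) (simp_all add: eval_1 eval_mult)

lemma eval_prod_mset: "mpoly_eval f \<sigma> (\<Prod>x\<in>#A. p x) = (\<Prod>x\<in>#A. mpoly_eval f \<sigma> (p x))"
  by (induction A) (simp_all add: eval_1 eval_mult)

lemma eval_psum: "mpoly_eval f \<sigma> (psum n k) = (\<Sum>v<n. \<sigma> v ^ k)"
  by (simp add: psum_def eval_sum eval_power eval_Var)

lemma eval_proper_prod:
  "mpoly_eval f \<sigma> (proper_prod n (c, M)) =
    (\<Prod>l\<le>(n - 1) div 2. (\<Sum>v<n. \<sigma> v ^ (2 * l + 1)) ^ c l) * (\<Prod>m\<in>#M. \<Sum>v<n. \<sigma> v ^ (2 * m + 1))"
  by (simp only: proper_prod_def prod.case eval_mult eval_prod eval_power eval_psum eval_prod_mset)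

end

lemma Const_add: "Const (x + y) = Const x + Const y"
  and Const_mult: "Const (x * y) = Const x * Const (y :: 'a::comm_ring_1)"
  and Const_0 [simp]: "Const 0 = 0" and Const_1 [simp]: "Const 1 = 1"
  by (simp_all add: Const_def single_add mult_single)

interpretation Const: coeff_hom Const
  by standard (simp_all add: Const_add Const_mult)

lemma subst_eq_eval: "subst \<sigma> p = mpoly_eval Const \<sigma> p"
  by (simp add: subst_def mpoly_eval_def monom_eval_def)

lemma subst_add: "subst \<sigma> (p + q) = subst \<sigma> p + subst \<sigma> q"
  and subst_mult: "subst \<sigma> (p * q) = subst \<sigma> p * subst \<sigma> q"
  and subst_Const: "subst \<sigma> (Const c) = Const c"
  and subst_psum: "subst \<sigma> (psum n k) = (\<Sum>v<n. \<sigma> v ^ k)"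
  by (simp_all add: subst_eq_eval Const.eval_add Const.eval_mult Const.eval_Const Const.eval_psum)

lemma poly_in_vars_add: "poly_in_vars n p \<Longrightarrow> poly_in_vars n q \<Longrightarrow> poly_in_vars n (p + q)"
  unfolding poly_in_vars_def using keys_add[of p q] by blast

lemma poly_in_vars_mult:
  assumes "poly_in_vars n p" "poly_in_vars n q"
  shows "poly_in_vars n (p * q)"
  unfolding poly_in_vars_def
proof
  fix m assume "m \<in> Poly_Mapping.keys (p * q)"
  then obtain a b where m: "m = a + b" "a \<in> Poly_Mapping.keys p" "b \<in> Poly_Mapping.keys q"
    using keys_mult[of p q] by blast
  then show "Poly_Mapping.keys m \<subseteq> {..<n}"
    using assms keys_add[of a b] unfolding poly_in_vars_def by blast
qed

lemma poly_in_vars_Const: "poly_in_vars n (Const c)"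
  by (auto simp: poly_in_vars_def Const_def)

lemma poly_in_vars_Var: "v < n \<Longrightarrow> poly_in_vars n (Var v)"
  by (auto simp: poly_in_vars_def Var_def split: if_splits)

lemma poly_in_vars_power: "poly_in_vars n p \<Longrightarrow> poly_in_vars n (p ^ k)"
  for p :: "'a::comm_ring_1 mpoly"
proof (induction k)
  case 0
  show ?case using poly_in_vars_Const[of n "1 :: 'a"] by simp
qed (simp add: poly_in_vars_mult)

lemma poly_in_vars_sum: "(\<And>x. x \<in> A \<Longrightarrow> poly_in_vars n (p x)) \<Longrightarrow> poly_in_vars n (\<Sum>x\<in>A. p x)"
proof (induction A rule: infinite_finite_induct)
qed (simp_all add: poly_in_vars_add, simp_all add: poly_in_vars_def)

definition free_of :: "nat \<Rightarrow> 'a::zero mpoly \<Rightarrow> bool" where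
  "free_of v p \<longleftrightarrow> (\<forall>m\<in>Poly_Mapping.keys p. lk m v = 0)"

lemma free_of_add: "free_of v p \<Longrightarrow> free_of v q \<Longrightarrow> free_of v (p + q)"
  unfolding free_of_def using keys_add[of p q] by blast

lemma free_of_mult:
  assumes "free_of v p" "free_of v q"
  shows "free_of v (p * q)"
  unfolding free_of_def
proof
  fix m assume "m \<in> Poly_Mapping.keys (p * q)"
  then obtain a b where m: "m = a + b" "a \<in> Poly_Mapping.keys p" "b \<in> Poly_Mapping.keys q"
    using keys_mult[of p q] by blast
  then show "lk m v = 0"
    using assms unfolding free_of_def by (simp add: lookup_add)
qed

lemma free_of_Const: "free_of v (Const c)"
  by (auto simp: free_of_def Const_def split: if_splits)

lemma free_of_Var: "v \<noteq> u \<Longrightarrow> free_of v (Var u)"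
  by (auto simp: free_of_def Var_def lookup_single when_def split: if_splits)

lemma free_of_power: "free_of v p \<Longrightarrow> free_of v (p ^ k)"
  for p :: "'a::comm_ring_1 mpoly"
proof (induction k)
  case 0
  show ?case using free_of_Const[of v "1 :: 'a"] by simp
qed (simp add: free_of_mult)

lemma free_of_sum: "(\<And>x. x \<in> A \<Longrightarrow> free_of v (p x)) \<Longrightarrow> free_of v (\<Sum>x\<in>A. p x)"
proof (induction A rule: infinite_finite_induct)
qed (simp_all add: free_of_add, simp_all add: free_of_def)

definition cancel_subst :: "nat \<Rightarrow> nat \<Rightarrow> 'a::comm_ring_1 mpoly" where
  "cancel_subst n = (\<lambda>v. if v = 0 then Var n else if v = 1 then - Var n else Var v)"

lemma T_iff: "p \<in> T n \<longleftrightarrow> poly_in_vars n p \<and>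
    (\<forall>\<pi>. \<pi> permutes {..<n} \<longrightarrow> subst (\<lambda>v. Var (\<pi> v)) p = p) \<and>
    (2 \<le> n \<longrightarrow> free_of n (subst (cancel_subst n) p))"
  by (simp add: T_def free_of_def cancel_subst_def)

lemma Const_in_T: "Const c \<in> T n"
  and T_add: "p \<in> T n \<Longrightarrow> q \<in> T n \<Longrightarrow> p + q \<in> T n"
  and T_mult: "p \<in> T n \<Longrightarrow> q \<in> T n \<Longrightarrow> p * q \<in> T n"
  by (simp_all add: T_iff subst_add subst_mult subst_Const free_of_add free_of_mult free_of_Const
      poly_in_vars_add poly_in_vars_mult poly_in_vars_Const)

lemma odd_psum_in_T: "psum n (2 * k + 1) \<in> T n"
  unfolding T_iff
proof (intro conjI allI impI)
  show "poly_in_vars n (psum n (2 * k + 1) :: 'a mpoly)"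
    unfolding psum_def by (intro poly_in_vars_sum poly_in_vars_power poly_in_vars_Var) simp
next
  fix \<pi> :: "nat \<Rightarrow> nat" assume "\<pi> permutes {..<n}"
  from sum.permute[OF this, of "\<lambda>v. Var v ^ (2 * k + 1) :: 'a mpoly"]
  show "subst (\<lambda>v. Var (\<pi> v)) (psum n (2 * k + 1)) = (psum n (2 * k + 1) :: 'a mpoly)"
    unfolding subst_psum unfolding psum_def by (simp add: o_def)
next
  assume n: "2 \<le> n"
  have "subst (cancel_subst n) (psum n (2 * k + 1)) =
      (\<Sum>v\<in>{0, 1} \<union> {2..<n}. cancel_subst n v ^ (2 * k + 1) :: 'a mpoly)"
    unfolding subst_psum using n by (intro sum.cong) auto
  also have "\<dots> = (\<Sum>v\<in>{2..<n}. cancel_subst n v ^ (2 * k + 1))"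
    by (subst sum.union_disjoint) (auto simp: cancel_subst_def)
  also have "free_of n \<dots>"
    by (intro free_of_sum free_of_power) (auto simp: cancel_subst_def free_of_Var)
  finally show "free_of n (subst (cancel_subst n) (psum n (2 * k + 1)) :: 'a mpoly)" .
qed

lemma subalg_gen_subset_T:
  "subalg_gen {psum n (2 * k + 1) | k. True} \<subseteq> (T n :: 'a::comm_ring_1 mpoly set)"
proof
  fix p :: "'a mpoly" assume "p \<in> subalg_gen {psum n (2 * k + 1) | k. True}"
  then show "p \<in> T n"
    by induction (use odd_psum_in_T in \<open>auto intro: Const_in_T T_add T_mult\<close>)
qed

lemma subalg_gen_1: "1 \<in> subalg_gen S"
  using subalg_gen.const[of 1] by simp

lemma subalg_gen_power: "p \<in> subalg_gen S \<Longrightarrow> p ^ k \<in> subalg_gen S"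
  by (induction k) (auto intro: subalg_gen_1 subalg_gen.mult)

lemma subalg_gen_prod: "(\<And>x. x \<in> A \<Longrightarrow> p x \<in> subalg_gen S) \<Longrightarrow> (\<Prod>x\<in>A. p x) \<in> subalg_gen S"
  by (induction A rule: infinite_finite_induct) (auto intro: subalg_gen_1 subalg_gen.mult)

lemma subalg_gen_prod_mset: "(\<And>x. p x \<in> subalg_gen S) \<Longrightarrow> (\<Prod>x\<in>#A. p x) \<in> subalg_gen S"
  by (induction A) (auto intro: subalg_gen_1 subalg_gen.mult)

lemma subalg_gen_sum: "(\<And>x. x \<in> A \<Longrightarrow> p x \<in> subalg_gen S) \<Longrightarrow> (\<Sum>x\<in>A. p x) \<in> subalg_gen S"
  using subalg_gen.const[of 0 S]
  by (induction A rule: infinite_finite_induct) (auto intro: subalg_gen.add)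

lemma proper_prod_in_subalg_gen: "proper_prod n x \<in> subalg_gen {psum n (2 * k + 1) | k. True}"
proof -
  have "psum n (2 * k + 1) \<in> subalg_gen {psum n (2 * k + 1) | k. True}" for k
    by (rule subalg_gen.gen) blast
  then show ?thesis
    unfolding proper_prod_def
    by (auto split: prod.splits intro!: subalg_gen.mult subalg_gen_prod subalg_gen_power subalg_gen_prod_mset)
qed

section \<open>Leading exponents of supersymmetric polynomials\<close>

definition strict_exp :: "(nat \<Rightarrow>\<^sub>0 nat) \<Rightarrow> bool" where
  "strict_exp m \<longleftrightarrow> (\<forall>v. lk m (Suc v) < lk m v \<or> lk m v = 0 \<and> lk m (Suc v) = 0)"

text \<open>Precomposition with \<open>\<pi>\<close>; renaming variables by \<open>\<pi>\<close>
  therefore acts on exponents through the inverse. The case distinction keeps the support finite for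
  every \<open>\<pi>\<close>.\<close>

lift_definition permute_exp :: "(nat \<Rightarrow> nat) \<Rightarrow> (nat \<Rightarrow>\<^sub>0 nat) \<Rightarrow> (nat \<Rightarrow>\<^sub>0 nat)" is
  "\<lambda>\<pi> m v. if bij \<pi> then m (\<pi> v) else m v"
proof -
  fix \<pi> :: "nat \<Rightarrow> nat" and m :: "nat \<Rightarrow> nat"
  assume fin: "finite {v. m v \<noteq> 0}"
  show "finite {v. (if bij \<pi> then m (\<pi> v) else m v) \<noteq> 0}"
  proof (cases "bij \<pi>")
    case True
    then show ?thesis using finite_vimageI[OF fin bij_is_inj[OF True]] by (simp add: vimage_def)
  qed (use fin in simp)
qed

lemma lookup_permute_exp: "bij \<pi> \<Longrightarrow> lk (permute_exp \<pi> m) v = lk m (\<pi> v)"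
  by transfer simp

lemma permute_exp_inv:
  assumes "bij \<pi>"
  shows "permute_exp \<pi> (permute_exp (inv_into UNIV \<pi>) m) = m"
  using assms by (intro poly_mapping_eqI) (simp add: lookup_permute_exp bij_imp_bij_inv bij_is_inj)

lemma Var_power: "Var v ^ k = (Poly_Mapping.single (Poly_Mapping.single v k) 1 :: 'a::comm_ring_1 mpoly)"
  by (induction k) (simp_all add: Var_def mult_single single_add[symmetric])

lemma prod_single: "(\<Prod>x\<in>A. Poly_Mapping.single (g x) (c x)) =
    (Poly_Mapping.single (\<Sum>x\<in>A. g x) (\<Prod>x\<in>A. c x) :: 'a::comm_ring_1 mpoly)"
  by (induction A rule: infinite_finite_induct) (simp_all add: mult_single)

lemma monom_eval_permute:
  assumes "bij \<pi>"
  shows "monom_eval (\<lambda>v. Var (\<pi> v)) m = (Poly_Mapping.single (permute_exp (inv_into UNIV \<pi>) m) 1 :: 'a::comm_ring_1 mpoly)"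
proof -
  have "(\<Sum>v\<in>Poly_Mapping.keys m. Poly_Mapping.single (\<pi> v) (lk m v)) = permute_exp (inv_into UNIV \<pi>) m"
  proof (rule poly_mapping_eqI)
    fix u
    have "lk (\<Sum>v\<in>Poly_Mapping.keys m. Poly_Mapping.single (\<pi> v) (lk m v)) u =
        (\<Sum>v\<in>Poly_Mapping.keys m. if v = inv_into UNIV \<pi> u then lk m v else 0)"
      unfolding lookup_sum using assms
      by (intro sum.cong) (auto simp: lookup_single when_def bij_inv_eq_iff bij_is_inj inv_f_f)
    also have "\<dots> = lk m (inv_into UNIV \<pi> u)" by (simp add: in_keys_iff)
    finally show "lk (\<Sum>v\<in>Poly_Mapping.keys m. Poly_Mapping.single (\<pi> v) (lk m v)) u = lk (permute_exp (inv_into UNIV \<pi>) m) u"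
      using assms by (simp add: lookup_permute_exp bij_imp_bij_inv)
  qed
  then show ?thesis by (simp add: monom_eval_def Var_power prod_single)
qed

lemma T_symmetric:
  assumes "p \<in> T n" "\<pi> permutes {..<n}"
  shows "lk p (permute_exp \<pi> m) = lk p m"
proof -
  have bij: "bij \<pi>" using assms(2) permutes_bij by blast
  have "subst (\<lambda>v. Var (\<pi> v)) p = p" using assms by (simp add: T_iff)
  then have "p = (\<Sum>m'\<in>Poly_Mapping.keys p. Poly_Mapping.single (permute_exp (inv_into UNIV \<pi>) m') (lk p m'))"
    by (simp add: subst_eq_eval mpoly_eval_def monom_eval_permute[OF bij] Const_def mult_single)
  then have "lk p m = lk (\<Sum>m'\<in>Poly_Mapping.keys p. Poly_Mapping.single (permute_exp (inv_into UNIV \<pi>) m') (lk p m')) m"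
    by simp
  also have "\<dots> = (\<Sum>m'\<in>Poly_Mapping.keys p. if m' = permute_exp \<pi> m then lk p m' else 0)"
  proof -
    have "permute_exp (inv_into UNIV \<pi>) m' = m \<longleftrightarrow> m' = permute_exp \<pi> m" for m'
      using permute_exp_inv[OF bij] permute_exp_inv[OF bij_imp_bij_inv[OF bij]] bij
      by (auto simp: inv_inv_eq)
    then show ?thesis unfolding lookup_sum by (intro sum.cong) (auto simp: lookup_single when_def)
  qed
  also have "\<dots> = lk p (permute_exp \<pi> m)" by (simp add: in_keys_iff)
  finally show ?thesis by simp
qed

text \<open>The exponent produced by \<open>cancel_subst\<close>, without its sign. Index
  \<open>n\<close> is fresh and carries the exponent of \<open>t\<close>.\<close>

lift_definition cancel_exp :: "nat \<Rightarrow> (nat \<Rightarrow>\<^sub>0 nat) \<Rightarrow> (nat \<Rightarrow>\<^sub>0 nat)" is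
  "\<lambda>n m v. if v = n then m 0 + m 1 else if v \<le> 1 then 0 else m v"
proof -
  fix n and m :: "nat \<Rightarrow> nat"
  assume "finite {v. m v \<noteq> 0}"
  then have "finite (insert n {v. m v \<noteq> 0})" by simp
  then show "finite {v. (if v = n then m 0 + m 1 else if v \<le> 1 then 0 else m v) \<noteq> 0}"
    by (rule rev_finite_subset) auto
qed

lemma monom_eval_cancel:
  assumes "Poly_Mapping.keys m \<subseteq> {..<n}" "2 \<le> n"
  shows "monom_eval (cancel_subst n) m = (Poly_Mapping.single (cancel_exp n m) ((-1) ^ lk m 1) :: 'a::comm_ring_1 mpoly)"
proof -
  have neg: "(- Var n) ^ k = (Poly_Mapping.single (Poly_Mapping.single n k) ((-1) ^ k) :: 'a mpoly)" for k
  proof -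
    have "(- Var n) ^ k = ((-1) ^ k * Var n ^ k :: 'a mpoly)" by (rule power_minus)
    also have "(-1) ^ k = (Poly_Mapping.single 0 ((-1) ^ k) :: 'a mpoly)"
      by (induction k) (simp_all add: mult_single single_uminus)
    finally show ?thesis by (simp add: Var_power mult_single)
  qed
  have "monom_eval (cancel_subst n) m = (\<Prod>v<n. cancel_subst n v ^ lk m v :: 'a mpoly)"
    using assms by (intro monom_eval_superset) auto
  also have "\<dots> = (\<Prod>v<n. Poly_Mapping.single (Poly_Mapping.single (if v \<le> 1 then n else v) (lk m v))
      (if v = 1 then (-1) ^ lk m 1 else 1))"
    by (intro prod.cong) (auto simp: cancel_subst_def neg Var_power)
  also have "\<dots> = Poly_Mapping.single (\<Sum>v<n. Poly_Mapping.single (if v \<le> 1 then n else v) (lk m v)) ((-1) ^ lk m 1)"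
    using assms by (simp add: prod_single)
  also have "(\<Sum>v<n. Poly_Mapping.single (if v \<le> 1 then n else v) (lk m v)) = cancel_exp n m"
  proof (rule poly_mapping_eqI)
    fix u
    have "lk (\<Sum>v<n. Poly_Mapping.single (if v \<le> 1 then n else v) (lk m v)) u =
       (\<Sum>v<n. if (if v \<le> 1 then n else v) = u then lk m v else 0)"
      unfolding lookup_sum by (intro sum.cong) (auto simp: lookup_single when_def)
    also have "\<dots> = lk (cancel_exp n m) u"
    proof (cases "u = n")
      case True
      have "(\<Sum>v<n. if (if v \<le> 1 then n else v) = u then lk m v else 0) = (\<Sum>v\<in>{0, 1}. lk m v)"
        using True assms(2) by (intro sum.mono_neutral_cong_right) auto
      then show ?thesis using True by (simp add: cancel_exp.rep_eq)
    next
      case False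
      have "(\<Sum>v<n. if (if v \<le> 1 then n else v) = u then lk m v else 0) = (\<Sum>v<n. if v = u then (if u \<le> 1 then 0 else lk m u) else 0)"
        using False by (intro sum.cong) auto
      also have "\<dots> = (if u \<le> 1 then 0 else lk m u)"
        using assms(1) by (auto simp: in_keys_iff subset_iff)
      finally show ?thesis using False by (simp add: cancel_exp.rep_eq)
    qed
    finally show "lk (\<Sum>v<n. Poly_Mapping.single (if v \<le> 1 then n else v) (lk m v)) u = lk (cancel_exp n m) u" .
  qed
  finally show ?thesis .
qed

lemma lookup_subst_cancel:
  assumes "poly_in_vars n p" "2 \<le> n"
  shows "lk (subst (cancel_subst n) p) u =
    (\<Sum>m\<in>{m \<in> Poly_Mapping.keys p. cancel_exp n m = u}. (-1) ^ lk m 1 * lk (p :: 'a::comm_ring_1 mpoly) m)"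
proof -
  have "subst (cancel_subst n) p =
      (\<Sum>m\<in>Poly_Mapping.keys p. Poly_Mapping.single (cancel_exp n m) ((-1) ^ lk m 1 * lk p m))"
    unfolding subst_eq_eval mpoly_eval_def using assms
    by (intro sum.cong) (simp_all add: monom_eval_cancel poly_in_vars_def Const_def mult_single mult.commute)
  then show ?thesis
    by (simp add: lookup_sum lookup_single when_def sum.inter_filter)
qed

text \<open>The order on exponents is lexicographic and compares low variables first, so moving a
  larger entry forward increases the exponent.\<close>

lemma permute_exp_less:
  assumes "a < b" "lk m a < lk m b"
  shows "m < permute_exp (transpose a b) m"
  unfolding less_poly_mapping.rep_eq less_fun_def using assms
  by (intro exI[of _ a]) (auto simp: lookup_permute_exp transpose_def)

lemma leading_exponent_strict:
  assumes p: "p \<in> T n" "p \<noteq> (0 :: 'a::field_char_0 mpoly)"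
  shows "strict_exp (Max (Poly_Mapping.keys p))"
proof -
  define m where "m = Max (Poly_Mapping.keys p)"
  have ne: "Poly_Mapping.keys p \<noteq> {}" using p by simp
  have mk: "m \<in> Poly_Mapping.keys p" unfolding m_def using ne by (intro Max_in) auto
  have max: "m' \<le> m" if "m' \<in> Poly_Mapping.keys p" for m' unfolding m_def using that by simp
  have vars: "poly_in_vars n p" using p by (simp add: T_iff)
  have sym: "permute_exp \<pi> m' \<in> Poly_Mapping.keys p \<longleftrightarrow> m' \<in> Poly_Mapping.keys p" if "\<pi> permutes {..<n}" for \<pi> m'
    using T_symmetric[OF p(1) that] by (simp add: in_keys_iff)
  have below: "v < n" if "lk m' v \<noteq> 0" "m' \<in> Poly_Mapping.keys p" for v m'
    using vars that unfolding poly_in_vars_def in_keys_iff[symmetric] by blast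
  have tr: "transpose a b permutes {..<n}" if "a < n" "b < n" for a b
    using that by (simp add: permutes_swap_id)
  have dec: "lk m (Suc v) \<le> lk m v" for v
  proof (rule ccontr)
    assume neg: "\<not> ?thesis"
    then have n: "Suc v < n" using below[OF _ mk, of "Suc v"] by simp
    then have "permute_exp (transpose v (Suc v)) m \<in> Poly_Mapping.keys p" using sym tr mk by simp
    from max[OF this] permute_exp_less[of v "Suc v" m] neg show False by simp
  qed
  have "lk m v = 0" if eq: "lk m (Suc v) = lk m v" for v
  proof (rule ccontr)
    assume pos: "lk m v \<noteq> 0"
    define r where "r = lk m v"
    have n: "Suc v < n" using below[OF _ mk, of "Suc v"] pos eq by simp
    \<comment> \<open>Symmetry allows the repeated exponent to be moved to the variables
      \<open>0\<close> and \<open>1\<close>, on which the substitution acts.\<close>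
    define \<pi> where "\<pi> = transpose 0 v \<circ> transpose 1 (Suc v)"
    have perm: "\<pi> permutes {..<n}" unfolding \<pi>_def using n tr by (intro permutes_compose) auto
    have bij: "bij \<pi>" using perm permutes_bij by blast
    have \<pi>01: "\<pi> 0 = v" "\<pi> 1 = Suc v" by (auto simp: \<pi>_def transpose_def)
    define u where "u = permute_exp \<pi> m"
    have u01: "lk u 0 = r" "lk u 1 = r" using bij \<pi>01 eq by (simp_all add: u_def lookup_permute_exp r_def)
    have uk: "u \<in> Poly_Mapping.keys p" using sym[OF perm] mk by (simp add: u_def)
    \<comment> \<open>Nothing cancels against \<open>u\<close>: a competitor agrees with
      \<open>u\<close> elsewhere and has sum \<open>2 * r\<close> in the two special places. An
      unequal pair has an entry above \<open>r\<close>; moved to position \<open>v\<close>, it would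
      give a key larger than \<open>m\<close>.\<close>
    have only: "m' = u" if m': "m' \<in> Poly_Mapping.keys p" "cancel_exp n m' = cancel_exp n u" for m'
    proof -
      have ge: "lk m' w = lk u w" if "1 < w" for w
      proof (cases "w = n")
        case True
        have "lk m'' n = 0" if "m'' \<in> Poly_Mapping.keys p" for m'' using below[OF _ that, of n] by (metis less_irrefl)
        then show ?thesis using True m'(1) uk by simp
      next
        case False
        then show ?thesis using arg_cong[OF m'(2), of "\<lambda>x. lk x w"] that by (simp add: cancel_exp.rep_eq)
      qed
      have s: "lk m' 0 + lk m' 1 = 2 * r"
        using arg_cong[OF m'(2), of "\<lambda>x. lk x n"] u01 by (simp add: cancel_exp.rep_eq)
      define \<sigma> where "\<sigma> = inv_into UNIV \<pi>"
      have \<sigma>: "\<sigma> permutes {..<n}" "bij \<sigma>" "\<sigma> v = 0" "\<sigma> (Suc v) = 1"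
        using permutes_inv[OF perm] bij_imp_bij_inv[OF bij] \<pi>01
          inv_f_f[OF bij_is_inj[OF bij], of 0] inv_f_f[OF bij_is_inj[OF bij], of 1] by (simp_all add: \<sigma>_def)
      define y where "y = permute_exp \<sigma> m'"
      have yk: "y \<in> Poly_Mapping.keys p" using sym[OF \<sigma>(1)] m' by (simp add: y_def)
      have ym: "lk y w = lk m w" if "w \<noteq> v" "w \<noteq> Suc v" for w
      proof -
        have "\<sigma> w \<noteq> \<sigma> v" "\<sigma> w \<noteq> \<sigma> (Suc v)" using that \<sigma>(2) by (auto dest: bij_is_inj injD)
        then have "1 < \<sigma> w" using \<sigma> by auto
        then have "lk y w = lk u (\<sigma> w)" using ge \<sigma> by (simp add: y_def lookup_permute_exp)
        also have "\<dots> = lk m w" using bij by (simp add: u_def \<sigma>_def lookup_permute_exp bij_is_surj surj_f_inv_f)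
        finally show ?thesis .
      qed
      have "lk m' 0 = r"
      proof (rule ccontr)
        assume r: "lk m' 0 \<noteq> r"
        define z where "z = (if r < lk y v then y else permute_exp (transpose v (Suc v)) y)"
        have yv: "lk y v = lk m' 0" "lk y (Suc v) = lk m' 1" using \<sigma> by (simp_all add: y_def lookup_permute_exp)
        have zk: "z \<in> Poly_Mapping.keys p" using yk sym[OF tr] n by (simp add: z_def)
        have "lk z w = lk m w" if "w < v" for w
          using that ym by (auto simp: z_def lookup_permute_exp transpose_def)
        moreover have "r < lk z v"
          using r s yv by (auto simp: z_def lookup_permute_exp)
        ultimately have "m < z"
          unfolding less_poly_mapping.rep_eq less_fun_def by (intro exI[of _ v]) (simp add: r_def)
        with max[OF zk] show False by simp
      qed
      then have "lk m' w = lk u w" for w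
        using ge[of w] s u01 by (cases "w = 0"; cases "w = 1") auto
      then show "m' = u" by (intro poly_mapping_eqI)
    qed
    have n2: "2 \<le> n" using n by simp
    have "{m' \<in> Poly_Mapping.keys p. cancel_exp n m' = cancel_exp n u} = {u}" using uk only by auto
    then have "lk (subst (cancel_subst n) p) (cancel_exp n u) = (-1) ^ r * lk p u"
      using u01 by (simp add: lookup_subst_cancel[OF vars n2])
    also have "\<dots> \<noteq> 0" using uk by (simp add: in_keys_iff)
    finally have "cancel_exp n u \<in> Poly_Mapping.keys (subst (cancel_subst n) p)" by (simp add: in_keys_iff)
    moreover have "free_of n (subst (cancel_subst n) p)" using p n2 by (simp add: T_iff)
    ultimately have "lk (cancel_exp n u) n = 0" by (simp add: free_of_def)
    then show False using u01 pos by (simp add: cancel_exp.rep_eq r_def)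
  qed
  then show ?thesis unfolding m_def[symmetric] strict_exp_def
    using dec by (metis le_neq_implies_less)
qed

section \<open>A bijection of Sylvester type\<close>

text \<open>
  A partition into odd parts \<open>2 * k + 1\<close> is encoded by the multiset \<open>P\<close> of the numbers \<open>k\<close>; \<open>part P s\<close> is
  its \<open>s\<close>-th largest element, counted from \<open>0\<close>. Truncated subtraction in \<open>sylvester\<close> produces the
  zeros that end the strict partition.
\<close>

definition count_ge :: "nat multiset \<Rightarrow> nat \<Rightarrow> nat" where
  "count_ge P k = size (filter_mset (\<lambda>x. k \<le> x) P)"

definition part :: "nat multiset \<Rightarrow> nat \<Rightarrow> nat" where
  "part P s = card {k. 1 \<le> k \<and> s < count_ge P k}"

text \<open>Sylvester's fish-hooks: draw each part \<open>2 * k + 1\<close> as a centred row of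
  dots, longest on top. Hook \<open>2 * s\<close> consists of the column \<open>s\<close> places
  right of the centre and the right arm of row \<open>s\<close>; hook \<open>2 * s + 1\<close> of
  the column \<open>s + 1\<close> places left and the left arm of row \<open>s\<close>. Subtracting
  \<open>r\<close> removes the dots of earlier hooks and the corner counted twice.\<close>

definition sylvester :: "nat multiset \<Rightarrow> nat \<Rightarrow> nat" where
  "sylvester P r = (if even r then part P (r div 2) + count_ge P (r div 2) - r
     else part P (r div 2) + count_ge P (r div 2 + 1) - r)"

text \<open>Only a preimage of each strict sequence is constructed; \<open>sylvester\<close>
  recovers the sequence from it, which gives injectivity.\<close>

locale strict_sequence =
  fixes L :: "nat \<Rightarrow> nat" and n :: nat
  assumes strict: "L (Suc v) < L v \<or> L v = 0 \<and> L (Suc v) = 0" and zero: "n \<le> v \<Longrightarrow> L v = 0"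
begin

text \<open>Half the number of positive entries, rounded down.\<close>

definition "h = (LEAST s. L (2 * s + 1) = 0)"

text \<open>The \<open>h - a\<close> differences are positive, so this is \<open>h\<close> plus the
  differences lowered by \<open>1\<close>. The staircase from \<open>2 * h\<close> down to
  \<open>1\<close> alone becomes \<open>h\<close> parts \<open>2 * h + 1\<close>; both have total
  \<open>h * (2 * h + 1)\<close>.\<close>

definition "big a = a + (\<Sum>s=a..<h. L (2 * s + 1) - L (2 * s + 2))"

definition "small l = (if l < h then L (2 * l) - L (2 * l + 1) - 1 else L (2 * l))"

text \<open>
  After subtracting the staircase from \<open>L\<close>, every column of odd height \<open>2 * l + 1\<close> becomes a part
  \<open>2 * l + 1\<close>, and every column of even height \<open>2 * s + 2\<close> adds \<open>2\<close> to each of the \<open>s + 1\<close> largest parts.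
  If the number of parts of \<open>L\<close> is odd, one extra part \<open>2 * h + 1\<close> is part of \<open>small h\<close>.
\<close>

definition odd_parts :: "nat multiset" where
  "odd_parts = (\<Sum>l\<le>h. replicate_mset (small l) l) + image_mset big (mset_set {..<h})"

lemma h: "L (2 * h + 1) = 0" and h_least: "s < h \<Longrightarrow> 0 < L (2 * s + 1)"
proof -
  have "L (2 * n + 1) = 0" by (rule zero) simp
  then show "L (2 * h + 1) = 0" unfolding h_def by (rule LeastI)
  show "0 < L (2 * s + 1)" if "s < h" using not_less_Least[of s "\<lambda>s. L (2 * s + 1) = 0"] that
    unfolding h_def by simp
qed

lemma L_antimono: "L (v + k) \<le> L v"
proof (induction k)
  case (Suc k)
  then show ?case using strict[of "v + k"] by auto
qed simp

lemma L_0: "2 * h < r \<Longrightarrow> L r = 0"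
  using L_antimono[of "2 * h + 1" "r - (2 * h + 1)"] h by simp

lemma L_decreasing: "r < 2 * h \<Longrightarrow> L (Suc r) < L r"
proof -
  assume r: "r < 2 * h"
  then have "0 < L (2 * (r div 2) + 1)" by (intro h_least) auto
  moreover have "L (2 * (r div 2) + 1) \<le> L r"
    using L_antimono[of r "2 * (r div 2) + 1 - r"] by (cases "even r") auto
  ultimately show ?thesis using strict[of r] by simp
qed

lemma h_le: "h \<le> n div 2"
proof (cases h)
  case (Suc k)
  then have "0 < L (2 * k + 1)" by (intro h_least) simp
  then have "2 * k + 1 < n" using zero[of "2 * k + 1"] by (cases "2 * k + 1 < n") simp_all
  then show ?thesis using Suc by simp
qed simp

lemma big_ge: "a < h \<Longrightarrow> h \<le> big a"
proof -
  assume a: "a < h"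
  have "(\<Sum>s=a..<h. 1) \<le> (\<Sum>s=a..<h. L (2 * s + 1) - L (2 * s + 2))"
  proof (rule sum_mono)
    fix s assume "s \<in> {a..<h}"
    then have "L (Suc (2 * s + 1)) < L (2 * s + 1)" by (intro L_decreasing) auto
    then show "1 \<le> L (2 * s + 1) - L (2 * s + 2)" by simp
  qed
  then show ?thesis using a by (simp add: big_def)
qed

lemma big_step: "Suc a < h \<Longrightarrow> big a = big (Suc a) + (L (2 * a + 1) - L (2 * a + 2)) - 1"
  by (simp add: big_def sum.atLeast_Suc_lessThan)

lemma big_antimono:
  assumes "a \<le> b" "b < h"
  shows "big b \<le> big a"
  using assms
proof (induction rule: dec_induct)
  case (step k)
  have "L (Suc (2 * k + 1)) < L (2 * k + 1)" using step by (intro L_decreasing) auto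
  then have "big (Suc k) \<le> big k" using big_step[of k] step by simp
  then show ?case using step by simp
qed simp

lemma count_ge_eq: "count_ge odd_parts k = (\<Sum>l\<in>{k..h}. small l) + card {a. a < h \<and> k \<le> big a}"
proof -
  have rep: "size (filter_mset ((\<le>) k) (replicate_mset m x)) = (if k \<le> x then m else 0)" for m x :: nat
    by (induction m) auto
  have "size (filter_mset ((\<le>) k) (\<Sum>l\<in>A. replicate_mset (small l) l)) = (\<Sum>l\<in>A. if k \<le> l then small l else 0)"
    if "finite A" for A
    using that by (induction A) (auto simp: rep)
  from this[OF finite_atMost] have "size (filter_mset ((\<le>) k) (\<Sum>l\<le>h. replicate_mset (small l) l)) =
      (\<Sum>l\<le>h. if k \<le> l then small l else 0)" .
  also have "\<dots> = (\<Sum>l\<in>{k..h}. small l)"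
    by (intro sum.mono_neutral_cong_right) auto
  finally have "size (filter_mset ((\<le>) k) (\<Sum>l\<le>h. replicate_mset (small l) l)) = (\<Sum>l\<in>{k..h}. small l)" .
  moreover have "size (filter_mset ((\<le>) k) (image_mset big (mset_set {..<h}))) = card {a. a < h \<and> k \<le> big a}"
    by (simp add: filter_mset_image_mset)
  ultimately show ?thesis by (simp add: count_ge_def odd_parts_def)
qed

lemma count_ge_le_h: "k \<le> h \<Longrightarrow> count_ge odd_parts k = (\<Sum>l\<in>{k..h}. small l) + h"
proof -
  assume "k \<le> h"
  then have "{a. a < h \<and> k \<le> big a} = {..<h}" using big_ge by fastforce
  then show ?thesis by (simp add: count_ge_eq)
qed

text \<open>As \<open>big\<close> is antitone, the \<open>a\<close> with
  \<open>k \<le> big a\<close> form an initial segment, and parts from \<open>small\<close> never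
  exceed \<open>h\<close>.\<close>

lemma less_count_ge_iff:
  assumes "s < h"
  shows "s < count_ge odd_parts k \<longleftrightarrow> k \<le> big s"
proof (cases "k \<le> h")
  case True
  then show ?thesis using assms count_ge_le_h[OF True] big_ge[OF assms] by simp
next
  case False
  then have c: "count_ge odd_parts k = card {a. a < h \<and> k \<le> big a}" by (simp add: count_ge_eq)
  show ?thesis
  proof
    assume "k \<le> big s"
    then have "{..s} \<subseteq> {a. a < h \<and> k \<le> big a}"
      using assms big_antimono[of _ s] by (auto intro: order.trans)
    from card_mono[OF _ this] show "s < count_ge odd_parts k" using c by simp
  next
    assume s: "s < count_ge odd_parts k"
    show "k \<le> big s"
    proof (rule ccontr)
      assume neg: "\<not> k \<le> big s"
      have "{a. a < h \<and> k \<le> big a} \<subseteq> {..<s}"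
      proof
        fix a assume a: "a \<in> {a. a < h \<and> k \<le> big a}"
        show "a \<in> {..<s}"
        proof (rule ccontr)
          assume "a \<notin> {..<s}"
          then have "big a \<le> big s" using a by (intro big_antimono) auto
          with a neg show False by simp
        qed
      qed
      from card_mono[OF _ this] s c show False by simp
    qed
  qed
qed

lemma part_eq_big: "s < h \<Longrightarrow> part odd_parts s = big s"
proof -
  assume "s < h"
  then have "{k. 1 \<le> k \<and> s < count_ge odd_parts k} = {1..big s}" by (auto simp: less_count_ge_iff)
  then show ?thesis by (simp add: part_def)
qed

lemma count_ge_h: "count_ge odd_parts h = h + L (2 * h)"
  by (simp add: count_ge_le_h small_def)

lemma count_ge_gt: "h < k \<Longrightarrow> count_ge odd_parts k \<le> h"
proof -
  assume "h < k"
  then have "count_ge odd_parts k = card {a. a < h \<and> k \<le> big a}" by (simp add: count_ge_eq)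
  also have "\<dots> \<le> card {..<h}" by (intro card_mono) auto
  finally show ?thesis by simp
qed

text \<open>At most \<open>h\<close> parts exceed \<open>h\<close>, so from position
  \<open>h\<close> on every part is at most \<open>h\<close>; this makes the hooks after number
  \<open>2 * h\<close> empty.\<close>

lemma part_ge: 
  assumes "h \<le> s"
  shows "part odd_parts s \<le> h"
    and "L (2 * h) = 0 \<Longrightarrow> 0 < h \<Longrightarrow> part odd_parts s < h"
    and "s = h \<Longrightarrow> 0 < L (2 * h) \<Longrightarrow> part odd_parts s = h"
proof -
  have sub: "{k. 1 \<le> k \<and> s < count_ge odd_parts k} \<subseteq> {1..h}"
  proof
    fix k assume "k \<in> {k. 1 \<le> k \<and> s < count_ge odd_parts k}"
    then show "k \<in> {1..h}" using count_ge_gt[of k] assms by (cases "h < k") auto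
  qed
  then show "part odd_parts s \<le> h" unfolding part_def using card_mono[OF _ sub] by simp
  show "part odd_parts s < h" if "L (2 * h) = 0" "0 < h"
  proof -
    have "h \<notin> {k. 1 \<le> k \<and> s < count_ge odd_parts k}" using count_ge_h that assms by simp
    with sub have "{k. 1 \<le> k \<and> s < count_ge odd_parts k} \<subset> {1..h}" using that by auto
    from psubset_card_mono[OF _ this] show ?thesis by (simp add: part_def)
  qed
  show "part odd_parts s = h" if s: "s = h" and pos: "0 < L (2 * h)"
  proof -
    have "h < count_ge odd_parts k" if "k \<le> h" for k
    proof -
      have "small h \<le> (\<Sum>l\<in>{k..h}. small l)" using that by (intro member_le_sum) auto
      then show ?thesis using that pos by (simp add: count_ge_le_h small_def)
    qed
    then have "{1..h} \<subseteq> {k. 1 \<le> k \<and> s < count_ge odd_parts k}" using s by auto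
    with sub have "{k. 1 \<le> k \<and> s < count_ge odd_parts k} = {1..h}" by blast
    then show ?thesis by (simp add: part_def)
  qed
qed

text \<open>Telescoping from \<open>L (2 * s)\<close> to \<open>L (2 * h)\<close>; the summand
  \<open>h - s\<close> restores the \<open>1\<close> that \<open>small\<close> subtracts for each
  \<open>l < h\<close>.\<close>

lemma sum_big_small:
  assumes "s \<le> h"
  shows "(\<Sum>l\<in>{s..h}. small l) + (h - s) + (\<Sum>l=s..<h. L (2 * l + 1) - L (2 * l + 2)) = L (2 * s)"
  using assms
proof (induction rule: inc_induct)
  case base
  show ?case by (simp add: small_def)
next
  case (step s)
  have "{s..h} = insert s {Suc s..h}" using step by auto
  then have "(\<Sum>l\<in>{s..h}. small l) = small s + (\<Sum>l\<in>{Suc s..h}. small l)" by simp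
  moreover have "(\<Sum>l=s..<h. L (2 * l + 1) - L (2 * l + 2)) =
     (L (2 * s + 1) - L (2 * s + 2)) + (\<Sum>l=Suc s..<h. L (2 * l + 1) - L (2 * l + 2))"
    using step by (simp add: sum.atLeast_Suc_lessThan)
  moreover have "L (Suc (2 * s)) < L (2 * s)" "L (Suc (2 * s + 1)) < L (2 * s + 1)"
    using step by (intro L_decreasing; simp)+
  ultimately show ?case using step by (simp add: small_def)
qed

lemma sylvester_odd_parts: "sylvester odd_parts r = L r"
proof -
  define s where "s = r div 2"
  consider "s < h" | "s = h" | "h < s" by linarith
  then show ?thesis
  proof cases
    case 1
    note eq = sum_big_small[of s] count_ge_le_h[of s] part_eq_big[OF 1]
    have L: "L (Suc (2 * s)) < L (2 * s)" "L (Suc (2 * s + 1)) < L (2 * s + 1)"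
      using 1 by (intro L_decreasing; simp)+
    have c: "count_ge odd_parts (s + 1) + small s = count_ge odd_parts s"
    proof -
      have "{s..h} = insert s {s + 1..h}" using 1 by auto
      then show ?thesis using 1 by (simp add: count_ge_le_h)
    qed
    have e: "part odd_parts s + count_ge odd_parts s = L (2 * s) + 2 * s"
      using eq 1 by (simp add: big_def)
    show ?thesis
    proof (cases "even r")
      case True
      then have "r = 2 * s" by (simp add: s_def)
      with e show ?thesis by (simp add: sylvester_def)
    next
      case False
      then have "r = 2 * s + 1" by (simp add: s_def)
      with e c L 1 show ?thesis by (simp add: sylvester_def small_def)
    qed
  next
    case 2
    show ?thesis
    proof (cases "even r")
      case True
      then have r: "r = 2 * h" using 2 by (auto simp: s_def)
      show ?thesis
      proof (cases "L (2 * h) = 0")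
        case True
        then show ?thesis using r part_ge(2)[of h] part_ge(1)[of h] count_ge_h by (cases "h = 0") (auto simp: sylvester_def)
      next
        case False
        then show ?thesis using r part_ge(3)[of h] count_ge_h by (simp add: sylvester_def)
      qed
    next
      case False
      then have r: "r = 2 * h + 1" using 2 by (metis s_def odd_two_times_div_two_succ)
      have "part odd_parts h \<le> h" "count_ge odd_parts (Suc h) \<le> h" using part_ge(1)[of h] count_ge_gt[of "Suc h"] by simp_all
      then have "sylvester odd_parts r = 0" unfolding r sylvester_def by simp
      then show ?thesis using h r by simp
    qed
  next
    case 3
    have "2 * h < r" using 3 by (auto simp: s_def)
    then have "L r = 0" by (rule L_0)
    moreover have "part odd_parts s \<le> h" using part_ge(1)[of s] 3 by simp
    moreover have "count_ge odd_parts s \<le> h" "count_ge odd_parts (s + 1) \<le> h" using count_ge_gt 3 by simp_all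
    ultimately show ?thesis using 3 by (auto simp: sylvester_def s_def)
  qed
qed

lemma weight_odd_parts: "(\<Sum>x\<in>#odd_parts. 2 * x + 1) = (\<Sum>r\<le>2 * h. L r)"
proof -
  have small: "(\<Sum>x\<in>#(\<Sum>l\<in>A. replicate_mset (small l) l). 2 * x + 1) = (\<Sum>l\<in>A. small l * (2 * l + 1))"
    if "finite A" for A
    using that by (induction A) (auto simp: sum_mset_replicate_mset)
  have big: "(\<Sum>x\<in>#image_mset big (mset_set {..<h}). 2 * x + 1) = (\<Sum>a<h. 2 * big a + 1)"
    by (simp add: image_mset.compositionality o_def sum_unfold_sum_mset)
  \<comment> \<open>The difference at \<open>s\<close> enters \<open>big a\<close> for exactly the
    \<open>s + 1\<close> indices \<open>a \<le> s\<close>.\<close>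
  have swap: "(\<Sum>a<h. \<Sum>s=a..<h. d s) = (\<Sum>s<h. (s + 1) * d s)" for d :: "nat \<Rightarrow> nat"
  proof -
    have "(\<Sum>a<h. \<Sum>s=a..<h. d s) = (\<Sum>a<h. \<Sum>s<h. if a \<le> s then d s else 0)"
      by (intro sum.cong refl sum.mono_neutral_cong_left) auto
    also have "\<dots> = (\<Sum>s<h. \<Sum>a<h. if a \<le> s then d s else 0)" by (rule sum.swap)
    also have "\<dots> = (\<Sum>s<h. \<Sum>a\<le>s. d s)"
      by (intro sum.cong refl sum.mono_neutral_cong_right) auto
    finally show ?thesis by simp
  qed
  define d where "d = (\<lambda>s. L (2 * s + 1) - L (2 * s + 2))"
  have "(\<Sum>a<h. 2 * big a + 1) = (\<Sum>a<h. (2 * a + 1) + 2 * (\<Sum>s=a..<h. d s))"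
    by (intro sum.cong) (simp_all add: big_def d_def)
  also have "\<dots> = (\<Sum>a<h. 2 * a + 1) + 2 * (\<Sum>a<h. \<Sum>s=a..<h. d s)"
    by (simp only: sum.distrib sum_distrib_left)
  finally have big': "(\<Sum>a<h. 2 * big a + 1) = (\<Sum>a<h. 2 * a + 1) + 2 * (\<Sum>s<h. (s + 1) * d s)"
    by (simp only: swap)
  have "(\<Sum>x\<in>#odd_parts. 2 * x + 1) = (\<Sum>l\<le>h. small l * (2 * l + 1)) + (\<Sum>a<h. 2 * big a + 1)"
    unfolding odd_parts_def image_mset_union sum_mset.union by (simp only: small[OF finite_atMost] big)
  also have "\<dots> =
      (\<Sum>l\<le>h. small l * (2 * l + 1)) + (\<Sum>a<h. 2 * a + 1) + 2 * (\<Sum>s<h. (s + 1) * (L (2 * s + 1) - L (2 * s + 2)))"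
    unfolding big' d_def by simp
  also have "\<dots> = (2 * h + 1) * L (2 * h) + (\<Sum>l<h. small l * (2 * l + 1) + (2 * l + 1) + 2 * (l + 1) * (L (2 * l + 1) - L (2 * l + 2)))"
  proof -
    have "small h = L (2 * h)" by (simp add: small_def)
    then show ?thesis
      by (simp only: lessThan_Suc_atMost[symmetric] sum.lessThan_Suc sum.distrib sum_distrib_left mult.assoc
          mult.commute[of "L (2 * h)"] add_ac)
  qed
  also have "\<dots> = (\<Sum>r\<le>2 * h. L r)"
  proof -
    \<comment> \<open>The first \<open>2 * k + 1\<close> rows counted by columns:
      \<open>L (2 * k)\<close> columns have full height, the others have height
      \<open>2 * l + 1\<close> or \<open>2 * l + 2\<close> with \<open>l < k\<close>.\<close>
    have "(2 * k + 1) * L (2 * k) + (\<Sum>l<k. small l * (2 * l + 1) + (2 * l + 1) + 2 * (l + 1) * (L (2 * l + 1) - L (2 * l + 2))) = (\<Sum>r\<le>2 * k. L r)"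
      if "k \<le> h" for k
      using that
    proof (induction k)
      case (Suc k)
      have L: "L (Suc (2 * k)) < L (2 * k)" "L (Suc (2 * k + 1)) < L (2 * k + 1)"
        using Suc by (intro L_decreasing; simp)+
      obtain x where x: "L (2 * k + 1) = L (2 * k + 2) + x" using L(2) by (auto simp: less_iff_Suc_add)
      obtain y where y: "L (2 * k) = L (2 * k + 1) + y + 1" using L(1) by (auto simp: less_iff_Suc_add)
      have "small k = y" using y Suc by (simp add: small_def)
      moreover have "(\<Sum>r\<le>2 * Suc k. L r) = (\<Sum>r\<le>2 * k. L r) + L (2 * k + 1) + L (2 * k + 2)" by simp
      moreover have "(2 * k + 1) * L (2 * k) + (\<Sum>l<k. small l * (2 * l + 1) + (2 * l + 1) + 2 * (l + 1) * (L (2 * l + 1) - L (2 * l + 2))) = (\<Sum>r\<le>2 * k. L r)"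
        using Suc by simp
      ultimately show ?case using x y by (simp add: algebra_simps)
    qed simp
    then show ?thesis by simp
  qed
  finally show ?thesis .
qed

text \<open>Only the \<open>h\<close> parts from \<open>big\<close> can exceed \<open>j\<close>.
  This is clear if \<open>h \<le> j\<close>; otherwise \<open>n = 2 * h\<close>, and
  \<open>L (2 * h) = 0\<close> excludes further parts of index \<open>h\<close>.\<close>

lemma size_filter_odd_parts: "size (filter_mset (\<lambda>m. (n - 1) div 2 < m) odd_parts) \<le> n div 2"
proof -
  define j where "j = (n - 1) div 2"
  have "count_ge odd_parts (Suc j) \<le> h"
  proof (cases "h \<le> j")
    case True
    then show ?thesis by (intro count_ge_gt) simp
  next
    case False
    then have "h = Suc j" "n \<le> 2 * h" using h_le by (auto simp: j_def)
    then show ?thesis using count_ge_h zero[of "2 * h"] by simp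
  qed
  then show ?thesis using h_le by (simp add: count_ge_def j_def Suc_le_eq)
qed

end

section \<open>The proper products span, once they are independent\<close>

definition exp_degree :: "(nat \<Rightarrow>\<^sub>0 nat) \<Rightarrow> nat" where
  "exp_degree m = (\<Sum>v\<in>Poly_Mapping.keys m. lk m v)"

lemma exp_degree_superset:
  assumes "finite V" "Poly_Mapping.keys m \<subseteq> V"
  shows "exp_degree m = (\<Sum>v\<in>V. lk m v)"
  unfolding exp_degree_def using assms by (intro sum.mono_neutral_left) (auto simp: in_keys_iff)

lemma exp_degree_add: "exp_degree (m + m') = exp_degree m + exp_degree m'"
proof -
  let ?V = "Poly_Mapping.keys m \<union> Poly_Mapping.keys m'"
  have "Poly_Mapping.keys (m + m') \<subseteq> ?V" by (rule keys_add)
  then show ?thesis by (simp add: exp_degree_superset[of ?V] lookup_add sum.distrib)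
qed

definition deg_le :: "nat \<Rightarrow> 'a::zero mpoly \<Rightarrow> bool" where
  "deg_le d p \<longleftrightarrow> (\<forall>m\<in>Poly_Mapping.keys p. exp_degree m \<le> d)"

lemma deg_le_mono: "deg_le d p \<Longrightarrow> d \<le> e \<Longrightarrow> deg_le e p"
  unfolding deg_le_def by (meson order.trans)

lemma deg_le_add: "deg_le d p \<Longrightarrow> deg_le d q \<Longrightarrow> deg_le d (p + q)"
  unfolding deg_le_def using keys_add[of p q] by blast

lemma deg_le_mult:
  assumes "deg_le d p" "deg_le e q"
  shows "deg_le (d + e) (p * q)"
  unfolding deg_le_def
proof
  fix m assume "m \<in> Poly_Mapping.keys (p * q)"
  then obtain a b where m: "m = a + b" "a \<in> Poly_Mapping.keys p" "b \<in> Poly_Mapping.keys q"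
    using keys_mult[of p q] by blast
  then have "exp_degree a \<le> d" "exp_degree b \<le> e" using assms by (auto simp: deg_le_def)
  then show "exp_degree m \<le> d + e" by (simp add: m exp_degree_add)
qed

lemma deg_le_Const: "deg_le d (Const c)"
  by (auto simp: deg_le_def Const_def exp_degree_def)

lemma deg_le_sum: "(\<And>x. x \<in> A \<Longrightarrow> deg_le d (p x)) \<Longrightarrow> deg_le d (\<Sum>x\<in>A. p x)"
proof (induction A rule: infinite_finite_induct)
qed (simp_all add: deg_le_add, simp_all add: deg_le_def)

lemma deg_le_psum: "deg_le k (psum n k :: 'a::comm_ring_1 mpoly)"
  unfolding psum_def Var_power
  by (intro deg_le_sum) (auto simp: deg_le_def exp_degree_def)

lemma lookup_Const_mult: "lk (Const c * p) m = c * lk p m"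
  for p :: "'a::comm_ring_1 mpoly"
  unfolding Const_def mult_map_scale_conv_mult[symmetric] by (simp add: Poly_Mapping.map.rep_eq when_def)

definition split_parts :: "nat \<Rightarrow> nat multiset \<Rightarrow> (nat \<Rightarrow> nat) \<times> nat multiset" where
  "split_parts n P = ((\<lambda>l. if (n - 1) div 2 < l then 0 else count P l), filter_mset (\<lambda>m. (n - 1) div 2 < m) P)"

lemma split_parts_inject: "split_parts n P = split_parts n Q \<Longrightarrow> P = Q"
proof (rule multiset_eqI)
  fix x assume eq: "split_parts n P = split_parts n Q"
  show "count P x = count Q x"
  proof (cases "(n - 1) div 2 < x")
    case True
    have "count (snd (split_parts n P)) x = count (snd (split_parts n Q)) x" using eq by simp
    then show ?thesis using True by (simp add: split_parts_def)
  next
    case False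
    have "fst (split_parts n P) x = fst (split_parts n Q) x" using eq by simp
    then show ?thesis using False by (simp add: split_parts_def)
  qed
qed

lemma proper_prod_split_parts:
  "proper_prod n (split_parts n P) = (\<Prod>x\<in>#P. psum n (2 * x + 1) :: 'a::comm_ring_1 mpoly)"
proof -
  define j where "j = (n - 1) div 2"
  have "(\<Prod>l\<le>j. g l ^ count P l) * (\<Prod>x\<in>#filter_mset (\<lambda>m. j < m) P. g x) = (\<Prod>x\<in>#P. g x)"
    for g :: "nat \<Rightarrow> 'a mpoly"
  proof (induction P)
    case (add x P)
    show ?case
    proof (cases "j < x")
      case True
      then have "(\<Prod>l\<le>j. g l ^ count (add_mset x P) l) = (\<Prod>l\<le>j. g l ^ count P l)"
        by (intro prod.cong) auto
      then show ?thesis using True add by (simp add: mult.left_commute)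
    next
      case False
      have "(\<Prod>l\<le>j. g l ^ count (add_mset x P) l) = (\<Prod>l\<le>j. (if l = x then g l else 1) * g l ^ count P l)"
        by (intro prod.cong) auto
      also have "\<dots> = g x * (\<Prod>l\<le>j. g l ^ count P l)"
        using False by (simp add: prod.distrib)
      finally show ?thesis using False add by (simp add: mult.assoc)
    qed
  qed simp
  from this[of "\<lambda>x. psum n (2 * x + 1)"] show ?thesis
    by (simp add: proper_prod_def split_parts_def j_def)
qed

lemma deg_le_odd_psum_product: "deg_le (\<Sum>x\<in>#P. 2 * x + 1) (\<Prod>x\<in>#P. psum n (2 * x + 1) :: 'a::comm_ring_1 mpoly)"
proof (induction P)
  case empty
  show ?case using deg_le_Const[of 0 "1 :: 'a"] by simp
next
  case (add x P)
  show ?case using deg_le_mult[OF deg_le_psum[of "2 * x + 1" n] add] by simp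
qed

lemma strict_exp_index:
  assumes "Poly_Mapping.keys m \<subseteq> {..<n}" "strict_exp m"
  shows "\<exists>P. sylvester P = lk m \<and> split_parts n P \<in> proper_index n \<and> (\<Sum>x\<in>#P. 2 * x + 1) = exp_degree m"
proof -
  interpret strict_sequence "lk m" n
  proof
    show "lk m v = 0" if "n \<le> v" for v using that assms(1) by (auto simp: in_keys_iff subset_iff)
  qed (use assms(2) in \<open>simp add: strict_exp_def\<close>)
  have "Poly_Mapping.keys m \<subseteq> {..2 * h}"
  proof
    fix r assume "r \<in> Poly_Mapping.keys m"
    then show "r \<in> {..2 * h}" using L_0[of r] by (cases "2 * h < r") (simp_all add: in_keys_iff)
  qed
  then have "exp_degree m = (\<Sum>r\<le>2 * h. lk m r)" by (intro exp_degree_superset) auto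
  then show ?thesis
    using sylvester_odd_parts weight_odd_parts size_filter_odd_parts
    by (intro exI[of _ odd_parts]) (auto simp: proper_index_def split_parts_def)
qed

lemma finite_bounded_exps: "finite {m. Poly_Mapping.keys m \<subseteq> {..<n} \<and> exp_degree m \<le> d}"
proof (rule finite_imageD)
  show "inj_on lk {m. Poly_Mapping.keys m \<subseteq> {..<n} \<and> exp_degree m \<le> d}"
    by (auto intro!: inj_onI poly_mapping_eqI)
  have "lk m v \<le> d" if "exp_degree m \<le> d" for m v
  proof (cases "v \<in> Poly_Mapping.keys m")
    case True
    then have "lk m v \<le> exp_degree m" unfolding exp_degree_def by (intro member_le_sum) auto
    then show ?thesis using that by simp
  qed (simp add: in_keys_iff)
  then have "lk ` {m. Poly_Mapping.keys m \<subseteq> {..<n} \<and> exp_degree m \<le> d} \<subseteq>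
      {f. \<forall>x. (x \<in> {..<n} \<longrightarrow> f x \<in> {..d}) \<and> (x \<notin> {..<n} \<longrightarrow> f x = 0)}"
    by (auto simp: in_keys_iff subset_iff)
  then show "finite (lk ` {m. Poly_Mapping.keys m \<subseteq> {..<n} \<and> exp_degree m \<le> d})"
    by (rule finite_subset) (intro finite_set_of_finite_funs; simp)
qed

lemma T_sum: "(\<And>x. x \<in> A \<Longrightarrow> p x \<in> T n) \<Longrightarrow> (\<Sum>x\<in>A. p x) \<in> T n"
  using Const_in_T[of 0 n]
  by (induction A rule: infinite_finite_induct) (auto intro: T_add)

text \<open>Besides \<open>f\<close> there are as many proper products as exponents in
  \<open>S\<close>, so some nontrivial combination \<open>g\<close> has no coefficient at
  \<open>S\<close>. Its leading exponent would lie in \<open>S\<close>, hence \<open>g = 0\<close>;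
  by independence \<open>f\<close> occurs in this relation and can be solved for.\<close>

lemma T_subset_span:
  fixes f :: "'a::field_char_0 mpoly"
  assumes f: "f \<in> T n"
    and indep: "\<And>J a. finite J \<Longrightarrow> J \<subseteq> proper_index n \<Longrightarrow>
      (\<Sum>x\<in>J. Const (a x) * (proper_prod n x :: 'a mpoly)) = 0 \<Longrightarrow> \<forall>x\<in>J. a x = 0"
  shows "\<exists>J a. f = (\<Sum>x\<in>J. Const (a x) * proper_prod n x) \<and> finite J \<and> J \<subseteq> proper_index n"
proof -
  define d where "d = (\<Sum>m\<in>Poly_Mapping.keys f. exp_degree m)"
  define S where "S = {m. (Poly_Mapping.keys m \<subseteq> {..<n} \<and> exp_degree m \<le> d) \<and> strict_exp m}"
  have finS: "finite S" unfolding S_def using finite_bounded_exps[of n d] by (rule finite_subset[rotated]) auto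
  have "\<forall>m\<in>S. \<exists>P. sylvester P = lk m \<and> split_parts n P \<in> proper_index n \<and> (\<Sum>x\<in>#P. 2 * x + 1) = exp_degree m"
    using strict_exp_index by (simp add: S_def)
  then obtain \<psi> where \<psi>: "\<And>m. m \<in> S \<Longrightarrow> sylvester (\<psi> m) = lk m"
    "\<And>m. m \<in> S \<Longrightarrow> split_parts n (\<psi> m) \<in> proper_index n"
    "\<And>m. m \<in> S \<Longrightarrow> (\<Sum>x\<in>#\<psi> m. 2 * x + 1) = exp_degree m"
    using bchoice[of S "\<lambda>m P. sylvester P = lk m \<and> split_parts n P \<in> proper_index n \<and> (\<Sum>x\<in>#P. 2 * x + 1) = exp_degree m"]
    by blast
  define I where "I = (\<lambda>m. split_parts n (\<psi> m)) ` S"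
  have I: "finite I" "I \<subseteq> proper_index n" using finS \<psi>(2) by (auto simp: I_def)
  have "inj_on (\<lambda>m. split_parts n (\<psi> m)) S"
  proof (rule inj_onI)
    fix m m' assume m: "m \<in> S" "m' \<in> S" "split_parts n (\<psi> m) = split_parts n (\<psi> m')"
    then have "\<psi> m = \<psi> m'" using split_parts_inject by blast
    then have "lk m = lk m'" by (simp only: \<psi>(1)[OF m(1), symmetric] \<psi>(1)[OF m(2), symmetric])
    then show "m = m'" unfolding poly_mapping_eq_iff .
  qed
  then have cardI: "card I = card S" by (simp add: I_def card_image)
  \<comment> \<open>\<open>None\<close> stands for \<open>f\<close>.\<close>
  define q where "q = (\<lambda>i. case i of None \<Rightarrow> f | Some x \<Rightarrow> proper_prod n x)"
  define K where "K = insert None (Some ` I)"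
  have K: "finite K" "card S < card K" using I cardI by (simp_all add: K_def card_image)
  have qT: "q i \<in> T n" for i
    using f proper_prod_in_subalg_gen[of n] subalg_gen_subset_T[of n] by (auto simp: q_def split: option.split)
  have qd: "deg_le d (q i)" if "i \<in> K" for i
  proof (cases i)
    case None
    have "exp_degree m \<le> d" if "m \<in> Poly_Mapping.keys f" for m
      unfolding d_def using that by (intro member_le_sum) auto
    then show ?thesis using None by (simp add: q_def deg_le_def)
  next
    case (Some x)
    then obtain m where m: "m \<in> S" "x = split_parts n (\<psi> m)"
      using \<open>i \<in> K\<close> by (auto simp: K_def I_def)
    have "exp_degree m \<le> d" using m by (simp add: S_def)
    then show ?thesis
      using deg_le_mono[OF deg_le_odd_psum_product[of "\<psi> m" n], of d] \<psi>(3)[OF m(1)] Some m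
      by (simp add: q_def proper_prod_split_parts)
  qed
  obtain a where a: "\<exists>i\<in>K. a i \<noteq> 0" "\<And>m. m \<in> S \<Longrightarrow> (\<Sum>i\<in>K. a i * lk (q i) m) = 0"
    using nontrivial_solution[OF finS K, of "\<lambda>i. lk (q i)"] by blast
  define g where "g = (\<Sum>i\<in>K. Const (a i) * q i)"
  have gT: "g \<in> T n" unfolding g_def using qT by (intro T_sum T_mult Const_in_T)
  have gd: "deg_le d g" unfolding g_def
    using deg_le_mult[OF deg_le_Const[of 0] qd] by (intro deg_le_sum) simp
  have "g = 0"
  proof (rule ccontr)
    assume g: "g \<noteq> 0"
    define m where "m = Max (Poly_Mapping.keys g)"
    have mk: "m \<in> Poly_Mapping.keys g" unfolding m_def using g by (intro Max_in) auto
    have "strict_exp m" unfolding m_def using leading_exponent_strict[OF gT g] .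
    moreover have "Poly_Mapping.keys m \<subseteq> {..<n}" using gT mk by (auto simp: T_iff poly_in_vars_def)
    moreover have "exp_degree m \<le> d" using gd mk by (simp add: deg_le_def)
    ultimately have "m \<in> S" by (simp add: S_def)
    then have "lk g m = 0" using a(2) by (simp add: g_def lookup_sum lookup_Const_mult)
    then show False using mk by (simp add: in_keys_iff)
  qed
  then have rel: "Const (a None) * f + (\<Sum>x\<in>I. Const (a (Some x)) * proper_prod n x) = 0"
    using I by (simp add: g_def K_def q_def sum.reindex)
  have "a None \<noteq> 0"
  proof
    assume 0: "a None = 0"
    then have "(\<Sum>x\<in>I. Const (a (Some x)) * proper_prod n x) = 0" using rel by simp
    from indep[OF I this] 0 a(1) show False by (auto simp: K_def)
  qed
  define b where "b = (\<lambda>x. - a (Some x) / a None)"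
  have "f = Const (1 / a None) * (Const (a None) * f)"
    using \<open>a None \<noteq> 0\<close> by (simp flip: mult.assoc Const_mult)
  also have "Const (a None) * f = (\<Sum>x\<in>I. Const (- a (Some x)) * proper_prod n x)"
    using rel by (simp add: add_eq_0_iff2 sum_negf Const_def single_uminus)
  also have "Const (1 / a None) * \<dots> = (\<Sum>x\<in>I. Const (b x) * proper_prod n x)"
    by (simp add: sum_distrib_left b_def flip: mult.assoc Const_mult)
  finally show ?thesis using I by blast
qed

section \<open>Linear independence of the proper products\<close>

text \<open>Padding with zeros makes all sizes equal to \<open>i\<close> without changing the
  products, since \<open>complete_sym i w 0 = 1\<close>. Genuine indices \<open>m - j\<close> are
  positive, so the padding can be removed again.\<close>

lemma shifted_complete_sym_independent:
  fixes b :: "nat multiset \<Rightarrow> 'k::field_char_0"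
  assumes fin: "finite \<M>" and size: "\<And>M. M \<in> \<M> \<Longrightarrow> size M \<le> i" and gt: "\<And>M m. M \<in> \<M> \<Longrightarrow> m \<in># M \<Longrightarrow> j < m"
    and zero: "\<And>w. (\<Sum>M\<in>\<M>. b M * (\<Prod>m\<in>#M. complete_sym i w (m - j))) = 0"
  shows "\<forall>M\<in>\<M>. b M = 0"
proof -
  define \<phi> where "\<phi> = (\<lambda>M. image_mset (\<lambda>m. m - j) M + replicate_mset (i - size M) 0)"
  have inv: "image_mset (\<lambda>m. m + j) (filter_mset (\<lambda>m. 0 < m) (\<phi> M)) = M" if "M \<in> \<M>" for M
  proof -
    have all: "filter_mset P N = N" if "\<And>x. x \<in># N \<Longrightarrow> P x" for P and N :: "nat multiset"
      using that by (induction N) auto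
    have "filter_mset (\<lambda>m. 0 < m) (image_mset (\<lambda>m. m - j) M) = image_mset (\<lambda>m. m - j) M"
    proof (rule all)
      fix x assume "x \<in># image_mset (\<lambda>m. m - j) M"
      then obtain m where m: "m \<in># M" "x = m - j" by auto
      from gt[OF that m(1)] show "0 < x" by (simp add: m(2))
    qed
    moreover have "filter_mset (\<lambda>m. 0 < m) (replicate_mset (i - size M) (0 :: nat)) = {#}"
      by (rule multiset_eqI) simp
    ultimately have "filter_mset (\<lambda>m. 0 < m) (\<phi> M) = image_mset (\<lambda>m. m - j) M"
      by (simp only: \<phi>_def filter_union_mset add_0_right)
    then have "image_mset (\<lambda>m. m + j) (filter_mset (\<lambda>m. 0 < m) (\<phi> M)) = image_mset (\<lambda>m. m - j + j) M"
      by (simp only: multiset.map_comp o_def)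
    also have "\<dots> = image_mset (\<lambda>m. m) M"
    proof (rule image_mset_cong)
      fix m assume "m \<in># M"
      from gt[OF that this] show "m - j + j = m" by simp
    qed
    finally show ?thesis by (simp only: multiset.map_ident)
  qed
  then have inj: "inj_on \<phi> \<M>" by (rule inj_on_inverseI)
  define c where "c = (\<lambda>N. b (image_mset (\<lambda>m. m + j) (filter_mset (\<lambda>m. 0 < m) N)))"
  have "\<forall>N\<in>\<phi> ` \<M>. c N = 0"
  proof (rule complete_sym_products_independent[where i = i])
    show "size N = i" if "N \<in> \<phi> ` \<M>" for N using that size by (auto simp: \<phi>_def)
    fix w :: "nat \<Rightarrow> 'k"
    have "(\<Sum>N\<in>\<phi> ` \<M>. c N * (\<Prod>m\<in>#N. complete_sym i w m)) = (\<Sum>M\<in>\<M>. b M * (\<Prod>m\<in>#\<phi> M. complete_sym i w m))"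
      using inv by (simp add: sum.reindex[OF inj] c_def)
    also have "\<dots> = (\<Sum>M\<in>\<M>. b M * (\<Prod>m\<in>#M. complete_sym i w (m - j)))"
      by (simp add: \<phi>_def image_mset.compositionality o_def)
    finally show "(\<Sum>N\<in>\<phi> ` \<M>. c N * (\<Prod>m\<in>#N. complete_sym i w m)) = 0" using zero by simp
  qed (use fin in simp)
  then show ?thesis using inv by (simp add: c_def)
qed

definition num_factors :: "nat \<Rightarrow> (nat \<Rightarrow> nat) \<times> nat multiset \<Rightarrow> nat" where
  "num_factors j x = (\<Sum>l\<le>j. fst x l) + size (snd x)"

text \<open>The shape of a proper product with arbitrary values for the power sums; multiplicativity
  then splits off powers of \<open>c\<close> and the factors \<open>2 * k + 1\<close>.\<close>

definition index_prod :: "nat \<Rightarrow> (nat \<Rightarrow> 'b::comm_monoid_mult) \<Rightarrow> (nat \<Rightarrow> nat) \<times> nat multiset \<Rightarrow> 'b" where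
  "index_prod j g x = (\<Prod>l\<le>j. g l ^ fst x l) * (\<Prod>m\<in>#snd x. g m)"

lemma index_prod_mult: "index_prod j (\<lambda>k. f k * g k) x = index_prod j f x * index_prod j g x"
  by (simp add: index_prod_def power_mult_distrib prod.distrib prod_mset.distrib mult_ac)

lemma index_prod_const: "index_prod j (\<lambda>_. c) x = c ^ num_factors j x"
  by (simp add: index_prod_def num_factors_def power_sum power_add image_mset_const_eq)

lemma poly_index_prod: "poly (index_prod j g x) c = index_prod j (\<lambda>k. poly (g k) c) x"
  for g :: "nat \<Rightarrow> 'k::comm_ring_1 poly"
proof -
  have "poly (\<Prod>m\<in>#M. g m) c = (\<Prod>m\<in>#M. poly (g m) c)" for M by (induction M) auto
  then show ?thesis by (simp add: index_prod_def poly_prod)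
qed

lemma index_prod_nonzero: "(\<And>k. g k \<noteq> 0) \<Longrightarrow> index_prod j g x \<noteq> (0 :: 'k::field)"
proof -
  assume g: "\<And>k. g k \<noteq> 0"
  have "(\<Prod>m\<in>#M. g m) \<noteq> 0" for M using g by (induction M) auto
  then show ?thesis using g by (simp add: index_prod_def)
qed

text \<open>Parameters \<open>u + \<epsilon> * s\<close> separate the two kinds of factors. At
  \<open>\<epsilon> = 0\<close> the high factors are independent complete symmetric functions of
  \<open>w\<close>, so for each \<open>M\<close> the polynomial in \<open>\<epsilon>\<close> formed
  by the low factors vanishes identically, although its value at \<open>0\<close> alone would not
  determine the \<open>b x\<close>.\<close>

lemma quot_series_products_independent:
  fixes b :: "(nat \<Rightarrow> nat) \<times> nat multiset \<Rightarrow> 'k::field_char_0"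
  assumes fin: "finite J" and J: "J \<subseteq> proper_index n"
  defines "i \<equiv> n div 2" and "j \<equiv> (n - 1) div 2"
  assumes zero: "\<And>w t. (\<Sum>x\<in>J. b x * index_prod j (fps_nth (quot_series i j w t)) x) = 0"
  shows "\<forall>x\<in>J. b x = 0"
proof -
  define u where "u = (\<lambda>l. if l = j then 1 else 0 :: 'k)"
  define \<M> where "\<M> = snd ` J"
  have fin\<M>: "finite \<M>" using fin by (simp add: \<M>_def)
  have size: "size M \<le> i" and gt: "m \<in># M \<Longrightarrow> j < m" if "M \<in> \<M>" for M m
    using that J by (auto simp: \<M>_def proper_index_def i_def j_def)
  have high: "fst x l = 0" if "x \<in> J" "j < l" for x l
  proof -
    obtain c M where x: "x = (c, M)" by fastforce
    then have "(c, M) \<in> proper_index n" using that J by blast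
    then show ?thesis using that x by (simp add: proper_index_def j_def)
  qed
  define fib where "fib = (\<lambda>M. {x \<in> J. snd x = M})"
  have poly0: "(\<Sum>x\<in>fib M. [:b x:] * (\<Prod>l\<le>j. [:u l, s l:] ^ fst x l)) = 0" if M: "M \<in> \<M>" for s M
  proof (rule lowest_order_vanishes[where \<M> = \<M> and M = M])
    define g where "g = (\<lambda>w M. \<Prod>m\<in>#M. [:complete_sym i w (m - j), fps_nth (quot_series i j w s) m:])"
    show "(\<Sum>M\<in>\<M>. (\<Sum>x\<in>fib M. [:b x:] * (\<Prod>l\<le>j. [:u l, s l:] ^ fst x l)) * g w M) = 0" for w
    proof (rule poly_eq_0_if_vanishes)
      fix \<epsilon>
      define t where "t = (\<lambda>l. u l + \<epsilon> * s l)"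
      define \<theta> where "\<theta> = fps_nth (quot_series i j w t)"
      have lo: "\<theta> l = poly [:u l, s l:] \<epsilon>" if "l \<le> j" for l
        using that by (simp add: \<theta>_def quot_series_low t_def mult.commute)
      have hi: "\<theta> m = poly [:complete_sym i w (m - j), fps_nth (quot_series i j w s) m:] \<epsilon>" if "j < m" for m
        using that quot_series_unit[of i j w "m - j"]
        by (simp add: \<theta>_def t_def quot_series_linear u_def)
      have pg: "poly (g w M) \<epsilon> = (\<Prod>m\<in>#M. \<theta> m)" if "M \<in> \<M>" for M
      proof -
        have "poly (\<Prod>m\<in>#N. f m) \<epsilon> = (\<Prod>m\<in>#N. poly (f m) \<epsilon>)" for N and f :: "nat \<Rightarrow> 'k poly"
          by (induction N) auto
        moreover have "image_mset (\<lambda>m. poly [:complete_sym i w (m - j), fps_nth (quot_series i j w s) m:] \<epsilon>) M = image_mset \<theta> M"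
          using gt[OF that] hi by (intro image_mset_cong) simp
        ultimately show ?thesis unfolding g_def by simp
      qed
      have "poly (\<Sum>M\<in>\<M>. (\<Sum>x\<in>fib M. [:b x:] * (\<Prod>l\<le>j. [:u l, s l:] ^ fst x l)) * g w M) \<epsilon> =
          (\<Sum>M\<in>\<M>. \<Sum>x\<in>fib M. b x * index_prod j \<theta> x)"
        unfolding poly_sum
      proof (rule sum.cong[OF refl])
        fix M assume "M \<in> \<M>"
        then show "poly ((\<Sum>x\<in>fib M. [:b x:] * (\<Prod>l\<le>j. [:u l, s l:] ^ fst x l)) * g w M) \<epsilon> = (\<Sum>x\<in>fib M. b x * index_prod j \<theta> x)"
          using lo by (simp add: poly_sum poly_prod pg sum_distrib_right fib_def index_prod_def mult.assoc)
      qed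
      also have "\<dots> = (\<Sum>x\<in>J. b x * index_prod j \<theta> x)"
        unfolding fib_def using fin fin\<M> by (intro sum.group) (auto simp: \<M>_def)
      finally show "poly (\<Sum>M\<in>\<M>. (\<Sum>x\<in>fib M. [:b x:] * (\<Prod>l\<le>j. [:u l, s l:] ^ fst x l)) * g w M) \<epsilon> = 0"
        using zero by (simp add: \<theta>_def)
    qed
    show "\<forall>M\<in>\<M>. d M = 0" if "\<And>w. (\<Sum>M\<in>\<M>. d M * poly (g w M) 0) = 0" for d
    proof (rule shifted_complete_sym_independent[OF fin\<M> size gt])
      have "poly (\<Prod>m\<in>#N. f m) 0 = (\<Prod>m\<in>#N. poly (f m) 0)" for N and f :: "nat \<Rightarrow> 'k poly"
        by (induction N) auto
      then show "(\<Sum>M\<in>\<M>. d M * (\<Prod>m\<in>#M. complete_sym i w (m - j))) = 0" for w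
        using that[of w] by (simp add: g_def)
    qed
  qed (rule M)
  show ?thesis
  proof
    fix x assume x: "x \<in> J"
    define M where "M = snd x"
    have M: "M \<in> \<M>" "x \<in> fib M" using x by (auto simp: M_def \<M>_def fib_def)
    have "\<forall>x\<in>fib M. b x = 0"
    proof (rule monomials_independent[where k = "Suc j" and e = fst])
      show "finite (fib M)" using fin by (simp add: fib_def)
      show "y = z" if "y \<in> fib M" "z \<in> fib M" "\<And>l. l < Suc j \<Longrightarrow> fst y l = fst z l" for y z
      proof -
        have "fst y l = fst z l" for l
        proof (cases "l < Suc j")
          case False
          then show ?thesis using that(1,2) high by (simp add: fib_def)
        qed (rule that(3))
        then show ?thesis using that(1,2) by (auto simp: fib_def prod_eq_iff)
      qed
      fix y :: "nat \<Rightarrow> 'k"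
      \<comment> \<open>At \<open>\<epsilon> = 1\<close> and with direction \<open>y - u\<close>,
        the low coefficients take the arbitrary values \<open>y\<close>.\<close>
      have "poly (\<Sum>x\<in>fib M. [:b x:] * (\<Prod>l\<le>j. [:u l, y l - u l:] ^ fst x l)) 1 = 0"
        by (simp only: poly0[OF M(1), of "\<lambda>l. y l - u l"] poly_0)
      then show "(\<Sum>x\<in>fib M. b x * (\<Prod>l<Suc j. y l ^ fst x l)) = 0"
        by (simp add: poly_sum poly_prod lessThan_Suc_atMost del: prod.lessThan_Suc)
    qed
    then show "b x = 0" using M by blast
  qed
qed

text \<open>Each factor of a product contributes one power of \<open>c\<close>, so after division by
  \<open>c ^ N\<close> only the indices with the least number \<open>N\<close> of factors survive at
  \<open>c = 0\<close>.\<close>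

lemma proper_prod_independent:
  fixes a :: "(nat \<Rightarrow> nat) \<times> nat multiset \<Rightarrow> 'a::field_char_0"
  assumes n: "1 \<le> n" and fin: "finite J" and J: "J \<subseteq> proper_index n"
    and zero: "(\<Sum>x\<in>J. Const (a x) * (proper_prod n x :: 'a mpoly)) = 0"
  shows "\<forall>x\<in>J. a x = 0"
proof (rule ccontr)
  assume neg: "\<not> ?thesis"
  define i where "i = n div 2"
  define j where "j = (n - 1) div 2"
  \<comment> \<open>Zero coefficients are discarded so that the least number of factors is attained
    by a term that really occurs.\<close>
  define J' where "J' = {x \<in> J. a x \<noteq> 0}"
  have J': "finite J'" "J' \<noteq> {}" "J' \<subseteq> proper_index n" using neg fin J by (auto simp: J'_def)
  interpret ac: coeff_hom "to_ac :: 'a \<Rightarrow> 'a alg_closure"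
    by standard simp_all
  have eval: "(\<Sum>x\<in>J'. to_ac (a x) * index_prod j (\<lambda>k. \<Sum>v<n. \<xi> v ^ (2 * k + 1)) x) = 0" for \<xi> :: "nat \<Rightarrow> 'a alg_closure"
  proof -
    have "mpoly_eval to_ac \<xi> (proper_prod n x) = index_prod j (\<lambda>k. \<Sum>v<n. \<xi> v ^ (2 * k + 1)) x" for x
      using ac.eval_proper_prod[of \<xi> n "fst x" "snd x"] by (simp add: index_prod_def j_def)
    then have "(\<Sum>x\<in>J. to_ac (a x) * index_prod j (\<lambda>k. \<Sum>v<n. \<xi> v ^ (2 * k + 1)) x) = 0"
      using arg_cong[OF zero, of "mpoly_eval to_ac \<xi>"] by (simp add: ac.eval_sum ac.eval_mult ac.eval_Const)
    moreover have "(\<Sum>x\<in>J'. to_ac (a x) * index_prod j (\<lambda>k. \<Sum>v<n. \<xi> v ^ (2 * k + 1)) x) =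
        (\<Sum>x\<in>J. to_ac (a x) * index_prod j (\<lambda>k. \<Sum>v<n. \<xi> v ^ (2 * k + 1)) x)"
      using fin by (intro sum.mono_neutral_left) (auto simp: J'_def)
    ultimately show ?thesis by simp
  qed
  define N where "N = Min (num_factors j ` J')"
  define J0 where "J0 = {x \<in> J'. num_factors j x = N}"
  have N: "N \<le> num_factors j x" if "x \<in> J'" for x using that J' by (simp add: N_def)
  have "N \<in> num_factors j ` J'" unfolding N_def using J' by (intro Min_in) auto
  then have J0: "J0 \<noteq> {}" "finite J0" "J0 \<subseteq> proper_index n" using J' by (auto simp: J0_def)
  \<comment> \<open>The factors \<open>2 * k + 1\<close> come from differentiating
    \<open>\<tau>\<close>; they are nonzero in characteristic \<open>0\<close>, so
    \<open>b x\<close> vanishes only with \<open>a x\<close>.\<close>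
  define b where "b = (\<lambda>x. to_ac (a x) * index_prod j (\<lambda>k. of_nat (2 * k + 1)) x :: 'a alg_closure)"
  have "\<forall>x\<in>J0. b x = 0"
  proof (rule quot_series_products_independent[OF J0(2,3), folded i_def j_def])
    fix w t :: "nat \<Rightarrow> 'a alg_closure"
    define q where "q = (\<lambda>k. psum_poly (fps_X * (quot_series i j w t oo fps_X\<^sup>2)) (2 * k))"
    \<comment> \<open>The relation as a polynomial in \<open>c\<close>, already divided by
      \<open>c ^ N\<close>. It vanishes because every value of \<open>c\<close> is realized by some
      \<open>\<xi>\<close>.\<close>
    define F where "F = (\<Sum>x\<in>J'. [:to_ac (a x):] * (Polynomial.monom 1 (num_factors j x - N) * index_prod j q x))"
    have "Polynomial.monom 1 N * F = 0"
    proof (rule poly_eq_0_if_vanishes)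
      fix c :: "'a alg_closure"
      have "2 * i \<le> n" "2 * j + 1 \<le> n" using n by (auto simp: i_def j_def)
      from odd_power_sums_realizable[OF this, where w = w and t = t and c = c]
      obtain \<xi> where \<xi>: "\<And>k. (\<Sum>v<n. \<xi> v ^ (2 * k + 1)) = c * poly (q k) c" unfolding q_def by blast
      have "poly (Polynomial.monom 1 N * F) c = (\<Sum>x\<in>J'. to_ac (a x) * (c ^ num_factors j x * index_prod j (\<lambda>k. poly (q k) c) x))"
        unfolding F_def poly_mult poly_sum poly_index_prod sum_distrib_left
      proof (rule sum.cong[OF refl])
        fix x assume "x \<in> J'"
        then have "c ^ num_factors j x = c ^ N * c ^ (num_factors j x - N)" using N by (simp flip: power_add)
        then show "poly (Polynomial.monom 1 N) c * (poly [:to_ac (a x):] c * (poly (Polynomial.monom 1 (num_factors j x - N)) c * index_prod j (\<lambda>k. poly (q k) c) x)) =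
            to_ac (a x) * (c ^ num_factors j x * index_prod j (\<lambda>k. poly (q k) c) x)"
          by (simp add: poly_monom mult_ac)
      qed
      also have "\<dots> = (\<Sum>x\<in>J'. to_ac (a x) * index_prod j (\<lambda>k. \<Sum>v<n. \<xi> v ^ (2 * k + 1)) x)"
        by (simp only: \<xi> index_prod_mult index_prod_const)
      finally show "poly (Polynomial.monom 1 N * F) c = 0" using eval by simp
    qed
    then have "F = 0" by (simp add: monom_eq_0_iff)
    then have "poly F 0 = 0" by simp
    moreover have "poly F 0 = (\<Sum>x\<in>J'. if num_factors j x = N then to_ac (a x) * index_prod j (\<lambda>k. poly (q k) 0) x else 0)"
      unfolding F_def poly_sum using N by (intro sum.cong) (auto simp: poly_index_prod poly_monom dest: N)
    moreover have "\<dots> = (\<Sum>x\<in>J0. b x * index_prod j (fps_nth (quot_series i j w t)) x)"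
      using J' unfolding J0_def sum.inter_filter[OF J'(1), symmetric]
      by (intro sum.cong) (simp_all only: q_def psum_poly_quot_series_0 index_prod_mult b_def mult.assoc)
    ultimately show "(\<Sum>x\<in>J0. b x * index_prod j (fps_nth (quot_series i j w t)) x) = 0" by simp
  qed
  moreover have "b x \<noteq> 0" if "x \<in> J0" for x
  proof -
    have "index_prod j (\<lambda>k. of_nat (2 * k + 1)) x \<noteq> (0 :: 'a alg_closure)"
      by (rule index_prod_nonzero) (simp del: of_nat_add of_nat_Suc of_nat_mult)
    then show ?thesis using that by (simp add: b_def J0_def J'_def)
  qed
  ultimately show False using J0 by blast
qed

theorem theorem1:
  fixes n :: nat
  assumes "1 \<le> n"
  shows "(T n :: 'a::field_char_0 mpoly set) = subalg_gen {psum n (2 * k + 1) | k. True}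
       \<and> (\<forall>J a. finite J \<and> J \<subseteq> proper_index n
              \<and> (\<Sum>x\<in>J. Const (a x) * (proper_prod n x :: 'a mpoly)) = 0
              \<longrightarrow> (\<forall>x\<in>J. a x = 0))
       \<and> (T n :: 'a mpoly set) =
           {\<Sum>x\<in>J. Const (a x) * proper_prod n x | J a. finite J \<and> J \<subseteq> proper_index n}"
proof -
  let ?S = "{psum n (2 * k + 1) | k. True} :: 'a mpoly set"
  let ?span = "{\<Sum>x\<in>J. Const (a x) * proper_prod n x | J a. finite J \<and> J \<subseteq> proper_index n} :: 'a mpoly set"
  note indep = proper_prod_independent[OF assms]
  have "subalg_gen ?S \<subseteq> T n" by (rule subalg_gen_subset_T)
  moreover have "T n \<subseteq> ?span"
  proof
    fix f :: "'a mpoly" assume "f \<in> T n"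
    then have "\<exists>J a. f = (\<Sum>x\<in>J. Const (a x) * proper_prod n x) \<and> finite J \<and> J \<subseteq> proper_index n"
      by (rule T_subset_span) (rule indep)
    then show "f \<in> ?span" unfolding mem_Collect_eq .
  qed
  moreover have "?span \<subseteq> subalg_gen ?S"
  proof
    fix f assume "f \<in> ?span"
    then obtain J a where f: "f = (\<Sum>x\<in>J. Const (a x) * proper_prod n x)" by blast
    show "f \<in> subalg_gen ?S"
      unfolding f by (intro subalg_gen_sum subalg_gen.mult subalg_gen.const proper_prod_in_subalg_gen)
  qed
  ultimately have "T n = subalg_gen ?S" "T n = ?span" by blast+
  then show ?thesis using indep by blast
qed

end
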